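(* Let $(A_1,\ldots,A_d)$, $d\ge 2$, be a positive definite (hence regular) SDC family of real symmetric $n\times n$ matrices, and let $\tilde A_k=A_k+\epsilon E_k$ for $k=1,\ldots,d$, where $\epsilon>0$ and $E_1,\ldots,E_d\in\mathbb{R}^{n\times n}$ satisfy $\|E_1\|_F^2+\cdots+\|E_d\|_F^2=1$. Let $m$ be the number of distinct eigenvalue vectors of the family $(A_1,\ldots,A_d)$. Assume that $\mu\sim\mathcal{N}(0,I_d)$ is a Gaussian random vector and that $\theta=[1/d,\ldots,1/d]$. If $\tilde X\in\mathbb{R}^{n\times n}$ is any invertible matrix such that $\tilde X^T\tilde A(\mu)\tilde X$ and $\tilde X^T\tilde A(\theta)\tilde X$ are diagonal then, for any $R>0$, $$\mathrm{Prob}\left(\frac{1}{\|\tilde X\|_2^2}\Big(\sum_{k=1}^d\big\|\mathrm{offdiag}(\tilde X^T\tilde A_k\tilde X)\big\|_F^2\Big)^{1/2}\le (1+R)\epsilon+\mathcal{O}(\epsilon^2)\right)\ge 1-\frac{3}{\sqrt{2\pi}}\,\frac{d^2m(m-1)}{R}.$$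
   Context: All matrices are real. For $\mu\in\mathbb{R}^d$ and a family $(A_1,\ldots,A_d)$, $A(\mu):=\mu_1A_1+\cdots+\mu_dA_d$, and likewise $\tilde A(\mu):=\mu_1\tilde A_1+\cdots+\mu_d\tilde A_d$. A family of symmetric matrices is SDC if there is an invertible $X\in\mathbb{R}^{n\times n}$ such that every $X^TA_kX$ is diagonal. A family is regular if the polynomial $\mu\mapsto\det(A(\mu))$ does not vanish identically. A family of symmetric matrices is positive definite if $A(\mu)$ is positive definite for every $\mu\in\mathbb{R}^d$ with all entries positive. $\mathrm{offdiag}(M)$ is the matrix obtained from $M$ by setting its diagonal entries to zero; $\|\cdot\|_F$ is the Frobenius norm and $\|\cdot\|_2$ the spectral norm. Definition of $m$: choose an invertible $X$ such that $D_k:=X^TA_kX$ is diagonal for all $k$, and $\theta_0\in\mathbb{R}^d$ such that $A(\theta_0)$ is invertible. Put $D(\theta_0)=\sum_k(\theta_0)_kD_k$ (which is invertible) and $\Lambda_k:=D_kD(\theta_0)^{-1}$. Then $m$ is the number of distinct vectors among $[\Lambda_1(i,i),\ldots,\Lambda_d(i,i)]\in\mathbb{R}^d$, $i=1,\ldots,n$; this number does not depend on the choice of $\theta_0$. The term $\mathcal{O}(\epsilon^2)$ is understood asymptotically as $\epsilon\to 0$ (for sufficiently small $\epsilon$); its constant may depend on the matrices $A_k$, $E_k$ and on $\mu$, but not on $\epsilon$ or $\tilde X$.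
   Formalization: The formal theorem excludes the case m = 1, n ≥ 2, d ≥ 3, R < √d − 1, in which the printed bound (probability 1) fails in general, e.g. for A_1 = dI, A_2 = … = A_d = 0 with suitable symmetric E_k. *)

theory Defs
  imports "HOL-Analysis.Analysis" "HOL-Probability.Probability"
begin

definition diagonal_matrix :: "real^'n^'n \<Rightarrow> bool" where
  "diagonal_matrix M \<longleftrightarrow> (\<forall>i j. i \<noteq> j \<longrightarrow> M $ i $ j = 0)"

definition offdiag :: "real^'n^'n \<Rightarrow> real^'n^'n" where
  "offdiag M = (\<chi> i j. if i = j then 0 else M $ i $ j)"

definition symmetric_matrix :: "real^'n^'n \<Rightarrow> bool" where
  "symmetric_matrix M \<longleftrightarrow> transpose M = M"

definition posdef_matrix :: "real^'n^'n \<Rightarrow> bool" where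
  "posdef_matrix M \<longleftrightarrow> symmetric_matrix M \<and> (\<forall>x. x \<noteq> 0 \<longrightarrow> x \<bullet> (M *v x) > 0)"

definition frobenius_norm :: "real^'n^'n \<Rightarrow> real" where
  "frobenius_norm M = sqrt (\<Sum>i\<in>UNIV. \<Sum>j\<in>UNIV. (M $ i $ j)\<^sup>2)"

definition spectral_norm :: "real^'n^'n \<Rightarrow> real" where
  "spectral_norm M = onorm (\<lambda>x. M *v x)"

definition lincomb :: "('d::finite \<Rightarrow> real^'n^'n) \<Rightarrow> real^'d \<Rightarrow> real^'n^'n" where
  "lincomb A \<mu> = (\<Sum>k\<in>UNIV. (\<mu> $ k) *\<^sub>R A k)"

definition congr :: "real^'n^'n \<Rightarrow> real^'n^'n \<Rightarrow> real^'n^'n" where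
  "congr X M = transpose X ** M ** X"

definition diagonalizes :: "real^'n^'n \<Rightarrow> ('d \<Rightarrow> real^'n^'n) \<Rightarrow> bool" where
  "diagonalizes X A \<longleftrightarrow> invertible X \<and> (\<forall>k. diagonal_matrix (congr X (A k)))"

definition sdc_family :: "('d \<Rightarrow> real^'n^'n) \<Rightarrow> bool" where
  "sdc_family A \<longleftrightarrow> (\<forall>k. symmetric_matrix (A k)) \<and> (\<exists>X. diagonalizes X A)"

definition posdef_family :: "('d::finite \<Rightarrow> real^'n^'n) \<Rightarrow> bool" where
  "posdef_family A \<longleftrightarrow> (\<forall>\<mu>. (\<forall>k. \<mu> $ k > 0) \<longrightarrow> posdef_matrix (lincomb A \<mu>))"

text \<open>
  The set of vectors $[\Lambda_1(i,i),\ldots,\Lambda_d(i,i)]$ for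
  $\Lambda_k = D_k D(\theta_0)^{-1}$ and $D_k = X^T A_k X$.  It is meaningful only if
  \<open>diagonalizes X A\<close> and \<open>lincomb A \<theta>\<^sub>0\<close> is invertible.
\<close>
definition eigenvalue_vectors ::
    "('d::finite \<Rightarrow> real^'n^'n) \<Rightarrow> real^'n^'n \<Rightarrow> real^'d \<Rightarrow> (real^'d) set" where
  "eigenvalue_vectors A X \<theta>\<^sub>0 =
     (let D = (\<lambda>k. congr X (A k));
          \<Lambda> = (\<lambda>k. D k ** matrix_inv (lincomb D \<theta>\<^sub>0))
      in range (\<lambda>i. \<chi> k. \<Lambda> k $ i $ i))"

definition std_gaussian_vector :: "'a measure \<Rightarrow> ('a \<Rightarrow> real^'d::finite) \<Rightarrow> bool" where
  "std_gaussian_vector M \<mu> \<longleftrightarrow>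
     prob_space M \<and>
     prob_space.indep_vars M (\<lambda>_. borel) (\<lambda>k \<omega>. \<mu> \<omega> $ k) UNIV \<and>
     (\<forall>k. distributed M lborel (\<lambda>\<omega>. \<mu> \<omega> $ k) std_normal_density)"

end

theory Submission
  imports Defs
begin

text \<open>
  Choose coordinates in which all \<open>A k\<close> are diagonal, and let \<open>v p\<close> be the vector of the
  \<open>p\<close>-th diagonal entries of the family.  Positive definiteness makes \<open>v p \<bullet> \<theta>\<close> positive, so the
  eigenvalue vectors can be normalised to \<open>\<kappa> p = v p / (v p \<bullet> \<theta>)\<close>; they have nonnegative entries
  with sum \<open>d\<close>, hence norm at most \<open>d\<close>, whereas \<open>norm \<theta> = 1 / sqrt d\<close>.

  Let \<open>y, z\<close> be two columns of a matrix that diagonalizes the perturbed pencil at \<open>\<mu>\<close> and \<open>\<theta>\<close>,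
  and let \<open>w\<close> be the vector, indexed by the family, of the corresponding off-diagonal entries of
  the perturbed matrices.  Diagonality says exactly \<open>w \<bullet> \<theta> = 0\<close> and \<open>w \<bullet> \<mu> = 0\<close>.  On the other
  hand \<open>w = (\<Sum>p. y p * z p * v p) + \<epsilon> e\<close>, where \<open>e\<close> collects the entries of the transformed
  \<open>E k\<close>.  Each column is a generalised eigenvector of a perturbed diagonal pencil, so up to
  \<open>O(\<epsilon>)\<close> it lives on the indices of a single eigenvalue vector (\<open>eigenvector_localised\<close>).  Thus
  in the sum all but two groups contribute \<open>O(\<epsilon>\<^sup>2)\<close>, that is,
  \<open>w = \<epsilon> e + a g + b h + O(\<epsilon>\<^sup>2)\<close> with eigenvalue vectors \<open>g, h\<close>.  Therefore \<open>w\<close> is, up to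
  \<open>O(\<epsilon>\<^sup>2)\<close>, the image of \<open>\<epsilon> e\<close> under the oblique projection onto the orthogonal complement of
  \<open>{\<theta>, \<mu>}\<close> along the span of \<open>g\<close> and \<open>h\<close>.  If all these projections have norm at most \<open>1 + R\<close>,
  summing over the pairs of columns gives the estimate, because the vectors \<open>e\<close> together form
  the matrices \<open>X\<^sup>T E k X\<close>, whose joint Frobenius norm is at most the squared spectral norm of
  \<open>X\<close> (\<open>perturbed_offdiag_bound\<close>).

  For \<open>g = h\<close> the projection along \<open>g\<close> onto the complement of \<open>\<theta>\<close>
  has norm \<open>norm g * norm \<theta>\<close>, at most \<open>sqrt d\<close>.  For \<open>g \<noteq> h\<close> and \<open>\<delta> = h - g\<close> its norm
  is at most \<open>sqrt d * norm \<delta> * norm \<mu> / \<bar>\<delta> \<bullet> \<mu>\<bar>\<close> (\<open>norm_of_twice_annihilated_le\<close>).  With \<open>k\<close> a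
  coordinate at which \<open>\<bar>\<delta> $ k\<bar>\<close> is largest, this exceeds \<open>1 + R\<close> only if \<open>\<bar>\<delta> \<bullet> \<mu>\<bar>\<close> is smaller
  than a multiple of the norm of the coordinates of \<open>\<mu>\<close> other than \<open>k\<close>.  These coordinates are
  independent of \<open>\<mu> $ k\<close>, whose density is at most \<open>1 / sqrt (2 * pi)\<close>, so Fubini bounds the
  probability by \<open>3 / sqrt (2 * pi) * d\<^sup>2 / R\<close>, and a union bound over the \<open>m * (m - 1)\<close> ordered
  pairs finishes the proof.

  The Fubini bound requires \<open>R \<ge> 2 * d\<^sup>2\<close>, which holds as soon as \<open>m \<ge> 2\<close> and the claimed
  probability is positive; then also \<open>sqrt d \<le> 1 + R\<close>.  For \<open>m = 1\<close> there are no pairs \<open>g \<noteq> h\<close>, and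
  \<open>sqrt d \<le> 1 + R\<close> is what the nondegeneracy hypothesis provides when \<open>d \<ge> 3\<close>.  For \<open>d = 2\<close> the
  vectors \<open>\<theta>\<close> and \<open>\<mu>\<close> almost surely span the plane, so \<open>w = 0\<close>.

  The event itself is a set defined by quantifiers over all small \<open>\<epsilon>\<close> and all matrices \<open>X\<close>; it is
  measurable because the set of counterexamples is a projection of a \<open>\<sigma>\<close>-compact set
  (\<open>perturbation_estimate_borel\<close>).
\<close>

section \<open>Spectral and Frobenius norms\<close>

lemma frobenius_norm_eq_norm: "frobenius_norm M = norm M"
  by (simp add: frobenius_norm_def norm_vec_def L2_set_def sum_nonneg)

lemma norm_matrix_vector_le: "norm (M *v x) \<le> norm M * norm (x::real^'n)" for M :: "real^'n^'m"
proof -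
  have "norm (M *v x) = L2_set (\<lambda>i. \<bar>M $ i \<bullet> x\<bar>) UNIV"
    by (simp add: norm_vec_def matrix_vector_mult_def inner_vec_def)
  also have "\<dots> \<le> L2_set (\<lambda>i. norm (M $ i) * norm x) UNIV"
    by (intro L2_set_mono) (simp_all add: Cauchy_Schwarz_ineq2)
  also have "\<dots> = norm M * norm x"
    by (simp add: norm_vec_def[of M] L2_set_left_distrib)
  finally show ?thesis .
qed

text \<open>
  For matrices the type-class norm is the Frobenius norm; the spectral norm is the operator norm,
  and it dominates products from either side.
\<close>
lemma norm_mult_le_spectral_norm: "norm (X *v x) \<le> spectral_norm X * norm x"
  unfolding spectral_norm_def by (intro onorm matrix_vector_mul_bounded_linear)

lemma spectral_norm_nonneg: "0 \<le> spectral_norm X"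
  unfolding spectral_norm_def by (intro onorm_pos_le matrix_vector_mul_bounded_linear)

lemma spectral_norm_pos:
  fixes X :: "real^'n^'n"
  assumes "invertible X" shows "0 < spectral_norm X"
proof (rule ccontr)
  assume "\<not> 0 < spectral_norm X"
  then have "X *v x = 0" for x
    using norm_mult_le_spectral_norm[of X x] spectral_norm_nonneg[of X] by simp
  then have zero: "X *v x = 0" for x .
  obtain B where "X ** B = mat 1" using assms unfolding invertible_def by blast
  then have "x = X *v (B *v x)" for x by (simp add: matrix_vector_mul_assoc)
  then have "(1 :: real^'n) = 0" by (simp add: zero)
  then show False by simp
qed

lemma norm_transpose: "norm (transpose X) = norm X" for X :: "real^'n^'m"
  unfolding norm_vec_def L2_set_def transpose_def
  by (simp add: sum_nonneg) (rule sum.swap)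

lemma transpose_mult_le_spectral_norm:
  "norm (transpose X *v x) \<le> spectral_norm X * norm x"
proof (cases "transpose X *v x = 0")
  case True then show ?thesis by (simp add: spectral_norm_nonneg)
next
  case False
  let ?y = "transpose X *v x"
  have "norm ?y * norm ?y = ?y \<bullet> ?y" by (simp add: dot_square_norm power2_eq_square)
  also have "\<dots> = x \<bullet> (X *v ?y)"
    by (simp add: dot_lmul_matrix transpose_matrix_vector)
  also have "\<dots> \<le> norm x * norm (X *v ?y)" by (rule norm_cauchy_schwarz)
  also have "\<dots> \<le> norm x * (spectral_norm X * norm ?y)"
    by (intro mult_left_mono norm_mult_le_spectral_norm) simp
  finally have "norm ?y * norm ?y \<le> (spectral_norm X * norm x) * norm ?y"
    by (simp add: mult_ac)
  then show ?thesis using False by simp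
qed

lemma norm_matrix_mult_le_spectral_norm: "norm (M ** X) \<le> spectral_norm X * norm M"
  for M X :: "real^'n^'n"
proof -
  have row: "(M ** X) $ i = transpose X *v (M $ i)" for i
    by (vector matrix_matrix_mult_def matrix_vector_mult_def transpose_def) (simp add: mult.commute)
  have "norm (M ** X) = L2_set (\<lambda>i. norm (transpose X *v (M $ i))) UNIV"
    by (simp only: norm_vec_def[of "M ** X"] row)
  also have "\<dots> \<le> L2_set (\<lambda>i. spectral_norm X * norm (M $ i)) UNIV"
    by (intro L2_set_mono transpose_mult_le_spectral_norm) simp
  also have "\<dots> = spectral_norm X * norm M"
    by (simp add: norm_vec_def[of M] L2_set_right_distrib spectral_norm_nonneg)
  finally show ?thesis .
qed

text \<open>
  The reason why the perturbation enters the final estimate with constant one: after division by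
  the squared spectral norm of \<open>X\<close>, a congruence does not increase the Frobenius norm.
\<close>
lemma norm_congr_le: "norm (congr X M) \<le> (spectral_norm X)\<^sup>2 * norm M"
proof -
  have "norm (congr X M) \<le> spectral_norm X * norm (transpose (transpose X ** M))"
    unfolding congr_def norm_transpose by (rule norm_matrix_mult_le_spectral_norm)
  also have "transpose (transpose X ** M) = transpose M ** X"
    by (simp add: matrix_transpose_mul)
  also have "spectral_norm X * norm (transpose M ** X)
      \<le> spectral_norm X * (spectral_norm X * norm (transpose M))"
    by (intro mult_left_mono norm_matrix_mult_le_spectral_norm spectral_norm_nonneg)
  finally show ?thesis by (simp add: norm_transpose power2_eq_square mult_ac)
qed

lemma norm_power2_eq_sum_columns: "(norm Y)\<^sup>2 = (\<Sum>i\<in>UNIV. (norm (column i Y))\<^sup>2)"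
  for Y :: "real^'n^'m"
proof -
  have "(norm Y)\<^sup>2 = (norm (transpose Y))\<^sup>2" by (simp add: norm_transpose)
  also have "\<dots> = (\<Sum>i\<in>UNIV. (norm (transpose Y $ i))\<^sup>2)"
    by (simp add: norm_vec_def[of "transpose Y"] L2_set_def sum_nonneg)
  finally show ?thesis by (simp add: transpose_def column_def)
qed

text \<open>
  Reorganises the family of matrices into vectors over the family index, one for each matrix
  entry; the whole estimate is carried out entrywise on these vectors.
\<close>
lemma sum_norm_power2_eq:
  fixes Q :: "'d::finite \<Rightarrow> real^'n^'m"
  shows "(\<Sum>k\<in>UNIV. (norm (Q k))\<^sup>2) = (\<Sum>(i,j)\<in>UNIV. (norm (\<chi> k. Q k $ i $ j))\<^sup>2)"
proof -
  have "(\<Sum>k\<in>UNIV. (norm (Q k))\<^sup>2) = (\<Sum>k\<in>UNIV. \<Sum>(i,j)\<in>UNIV \<times> UNIV. (Q k $ i $ j)\<^sup>2)"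
  proof (rule sum.cong)
    fix k
    show "(norm (Q k))\<^sup>2 = (\<Sum>(i,j)\<in>UNIV \<times> UNIV. (Q k $ i $ j)\<^sup>2)"
      unfolding sum.cartesian_product[symmetric] by (simp add: norm_vec_def L2_set_def sum_nonneg)
  qed simp
  also have "\<dots> = (\<Sum>ij\<in>UNIV \<times> UNIV. \<Sum>k\<in>UNIV. (Q k $ fst ij $ snd ij)\<^sup>2)"
    unfolding case_prod_beta by (rule sum.swap)
  also have "\<dots> = (\<Sum>(i,j)\<in>UNIV. (norm (\<chi> k. Q k $ i $ j))\<^sup>2)"
    by (simp add: norm_vec_def L2_set_def sum_nonneg case_prod_beta)
  finally show ?thesis .
qed

section \<open>Congruence and linear combinations\<close>

lemma congr_component: "congr X M $ i $ j = column i X \<bullet> (M *v column j X)"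
proof -
  have "column i X \<bullet> (M *v column j X) = (\<Sum>p\<in>UNIV. \<Sum>q\<in>UNIV. X $ p $ i * (M $ p $ q * X $ q $ j))"
    by (simp add: inner_vec_def column_def matrix_vector_mult_def sum_distrib_left)
  also have "\<dots> = (\<Sum>q\<in>UNIV. \<Sum>p\<in>UNIV. X $ p $ i * (M $ p $ q * X $ q $ j))" by (rule sum.swap)
  also have "\<dots> = congr X M $ i $ j"
    by (simp add: congr_def matrix_matrix_mult_def transpose_def sum_distrib_left sum_distrib_right mult_ac)
  finally show ?thesis by simp
qed

lemma lincomb_mult_vector: "lincomb A \<mu> *v x = (\<Sum>k\<in>UNIV. (\<mu> $ k) *\<^sub>R (A k *v x))"
proof -
  have "(\<Sum>k\<in>S. (\<mu> $ k) *\<^sub>R A k) *v x = (\<Sum>k\<in>S. (\<mu> $ k) *\<^sub>R (A k *v x))" if "finite S" for S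
    using that by (induction) (auto simp: matrix_vector_mult_add_rdistrib scaleR_matrix_vector_assoc)
  then show ?thesis unfolding lincomb_def by simp
qed

lemma congr_lincomb_component:
  "congr X (lincomb A \<mu>) $ i $ j = (\<chi> k. congr X (A k) $ i $ j) \<bullet> \<mu>"
proof -
  have "congr X (lincomb A \<mu>) $ i $ j = (\<Sum>k\<in>UNIV. \<mu> $ k * congr X (A k) $ i $ j)"
    by (simp add: congr_component lincomb_mult_vector inner_sum_right)
  then show ?thesis by (simp add: inner_vec_def mult.commute)
qed

lemma lincomb_congr: "congr X (lincomb A \<mu>) = lincomb (\<lambda>k. congr X (A k)) \<mu>"
  by (simp add: vec_eq_iff congr_lincomb_component) (simp add: lincomb_def inner_vec_def mult.commute)

lemma congr_congr: "congr Y (congr X M) = congr (X ** Y) M"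
  by (simp add: congr_def matrix_transpose_mul matrix_mul_assoc)

lemma congr_add_scaleR: "congr X (M + c *\<^sub>R N) = congr X M + c *\<^sub>R congr X N"
  by (simp add: vec_eq_iff congr_component matrix_vector_mult_add_rdistrib inner_add_right
      scaleR_matrix_vector_assoc[symmetric])

lemma lincomb_perturbed: "lincomb (\<lambda>k. A k + \<epsilon> *\<^sub>R E k) \<xi> = lincomb A \<xi> + \<epsilon> *\<^sub>R lincomb E \<xi>"
  by (simp add: lincomb_def scaleR_add_right sum.distrib scaleR_sum_right mult.commute)

lemma diagonal_matrix_mult_vector:
  assumes "diagonal_matrix D"
  shows "D *v y = (\<chi> p. D $ p $ p * y $ p)"
proof -
  have "(\<Sum>q\<in>UNIV. D $ p $ q * y $ q) = (\<Sum>q\<in>UNIV. if q = p then D $ p $ p * y $ p else 0)" for p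
    using assms by (intro sum.cong) (auto simp: diagonal_matrix_def)
  then show ?thesis by (simp add: vec_eq_iff matrix_vector_mult_def)
qed

lemma diagonal_matrix_mult_component:
  assumes "diagonal_matrix D"
  shows "(D ** N) $ i $ j = D $ i $ i * N $ i $ j"
proof -
  have "(D ** N) $ i $ j = (\<Sum>k\<in>UNIV. if k = i then D $ i $ i * N $ i $ j else 0)"
    unfolding matrix_matrix_mult_def vec_lambda_beta using assms
    by (intro sum.cong) (auto simp: diagonal_matrix_def)
  then show ?thesis by simp
qed

section \<open>Distinct eigenvalue vectors\<close>

text \<open>
  Inverting the diagonal matrix \<open>D(\<theta>)\<close> divides the \<open>p\<close>-th diagonal entries by \<open>v p \<bullet> \<theta>\<close>, so the
  eigenvalue vectors are the \<open>v p\<close> rescaled to lie in the affine hyperplane of vectors whose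
  inner product with \<open>\<theta>\<close> is one.
\<close>
lemma eigenvalue_vectors_eq:
  fixes A :: "'d::finite \<Rightarrow> real^'n^'n"
  assumes X: "diagonalizes X A" and \<theta>: "invertible (lincomb A \<theta>)"
  defines "v \<equiv> \<lambda>p. \<chi> k. congr X (A k) $ p $ p"
  shows "eigenvalue_vectors A X \<theta> = range (\<lambda>p. v p /\<^sub>R (v p \<bullet> \<theta>))"
    and "v p \<bullet> \<theta> \<noteq> 0"
proof -
  define Q where "Q = congr X (lincomb A \<theta>)"
  have diag: "diagonal_matrix (congr X (A k))" for k using X by (simp add: diagonalizes_def)
  then have Qd: "diagonal_matrix Q"
    by (simp add: Q_def diagonal_matrix_def congr_lincomb_component inner_vec_def)
  have "invertible Q" using X \<theta> unfolding Q_def congr_def diagonalizes_def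
    by (simp add: invertible_mult transpose_invertible)
  then have "Q ** matrix_inv Q = mat 1"
    unfolding invertible_def matrix_inv_def by (rule someI2_ex) simp
  then have "(Q ** matrix_inv Q) $ p $ p = 1" for p by (simp add: mat_def)
  then have inv: "(v p \<bullet> \<theta>) * matrix_inv Q $ p $ p = 1" for p
    unfolding diagonal_matrix_mult_component[OF Qd] by (simp add: Q_def congr_lincomb_component v_def)
  then show "v p \<bullet> \<theta> \<noteq> 0" by (metis mult_zero_left zero_neq_one)
  have "matrix_inv Q $ p $ p = inverse (v p \<bullet> \<theta>)" for p using inverse_unique[OF inv[of p]] by (rule sym)
  then show "eigenvalue_vectors A X \<theta> = range (\<lambda>p. v p /\<^sub>R (v p \<bullet> \<theta>))"
    unfolding eigenvalue_vectors_def Let_def lincomb_congr[symmetric] Q_def[symmetric]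
    by (simp add: diagonal_matrix_mult_component[OF diag] vec_eq_iff v_def mult.commute scaleR_vec_def)
qed

text \<open>
  Two rescaled vectors agree precisely when the original ones are parallel.  Hence the number of
  distinct eigenvalue vectors does not depend on the reference point, and the averaging vector
  may replace the given one.
\<close>
lemma normalisation_eq_transfer:
  fixes v w a b :: "'a::real_inner"
  assumes "v /\<^sub>R (v \<bullet> a) = w /\<^sub>R (w \<bullet> a)" "v \<bullet> a \<noteq> 0" "w \<bullet> a \<noteq> 0"
  shows "v /\<^sub>R (v \<bullet> b) = w /\<^sub>R (w \<bullet> b)"
proof -
  define c where "c = (v \<bullet> a) / (w \<bullet> a)"
  have "(v \<bullet> a) *\<^sub>R (v /\<^sub>R (v \<bullet> a)) = (v \<bullet> a) *\<^sub>R (w /\<^sub>R (w \<bullet> a))" by (simp only: assms(1))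
  then have v: "v = c *\<^sub>R w" using assms(2) by (simp add: c_def divide_inverse)
  have "c \<noteq> 0" using assms by (simp add: c_def)
  then show ?thesis unfolding v by (simp add: mult.commute)
qed

lemma card_range_eq:
  assumes "\<And>p q. f p = f q \<longleftrightarrow> g p = g q"
  shows "card (range f) = card (range g)"
proof (rule bij_betw_same_card)
  have *: "g (inv f (f p)) = g p" for p using assms f_inv_into_f[of "f p" f UNIV] by blast
  show "bij_betw (\<lambda>y. g (inv f y)) (range f) (range g)"
    unfolding bij_betw_def inj_on_def
  proof (intro conjI ballI impI)
    fix x y assume "x \<in> range f" "y \<in> range f" "g (inv f x) = g (inv f y)"
    then show "x = y" using assms * by (metis imageE)
  next
    show "(\<lambda>y. g (inv f y)) ` range f = range g" unfolding image_image * ..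
  qed
qed

section \<open>Oblique projections\<close>

text \<open>
  The vector \<open>w\<close> is the oblique projection of \<open>w + a l\<close> along \<open>l\<close> onto the orthogonal complement of
  \<open>t\<close>, and for \<open>l \<bullet> t \<noteq> 0\<close> that projection has norm at most
  \<open>norm l * norm t / \<bar>l \<bullet> t\<bar>\<close>.  The proof is Cauchy-Schwarz for
  \<open>w\<close> and the part of \<open>l\<close> that is orthogonal to \<open>t\<close>.
\<close>
lemma oblique_norm_le:
  fixes w l t :: "'a::real_inner"
  assumes "w \<bullet> t = 0"
  shows "norm w * \<bar>l \<bullet> t\<bar> \<le> norm l * norm t * norm (w + a *\<^sub>R l)"
proof -
  define u where "u = w + a *\<^sub>R l"
  define T where "T = t \<bullet> t"
  define L where "L = l \<bullet> l"
  define s where "s = l \<bullet> t"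
  have T0: "T \<ge> 0" by (simp add: T_def)
  have 1: "(w \<bullet> l)\<^sup>2 * T \<le> (w \<bullet> w) * (L * T - s\<^sup>2)"
  proof (cases "t = 0")
    case False
    then have Tp: "T > 0" by (simp add: T_def)
    define l' where "l' = T *\<^sub>R l - s *\<^sub>R t"
    have "w \<bullet> l' = T * (w \<bullet> l)" using assms by (simp add: l'_def inner_diff_right)
    moreover have "l' \<bullet> l' = T * (T * L - s\<^sup>2)"
      by (simp add: l'_def inner_diff_left inner_diff_right T_def L_def s_def inner_commute
          power2_eq_square algebra_simps)
    ultimately have "T * ((w \<bullet> l)\<^sup>2 * T) \<le> T * ((w \<bullet> w) * (L * T - s\<^sup>2))"
      using Cauchy_Schwarz_ineq[of w l'] by (simp add: power_mult_distrib power2_eq_square mult_ac)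
    then show ?thesis using Tp by simp
  qed (simp add: T_def s_def)
  have uu: "u \<bullet> u = w \<bullet> w + 2 * a * (w \<bullet> l) + a\<^sup>2 * L"
    by (simp add: u_def inner_add_left inner_add_right inner_commute L_def power2_eq_square)
  have "L * (u \<bullet> u) = (w \<bullet> w) * L - (w \<bullet> l)\<^sup>2 + (w \<bullet> l + a * L)\<^sup>2"
    unfolding uu by (simp add: power2_eq_square algebra_simps)
  then have "T * (L * (u \<bullet> u)) \<ge> T * ((w \<bullet> w) * L - (w \<bullet> l)\<^sup>2)"
    using T0 by (intro mult_left_mono) auto
  with 1 have "(w \<bullet> w) * s\<^sup>2 \<le> L * T * (u \<bullet> u)" by (simp add: algebra_simps)
  then have "(norm w * \<bar>s\<bar>)\<^sup>2 \<le> (norm l * norm t * norm u)\<^sup>2"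
    by (simp add: power_mult_distrib L_def T_def dot_square_norm)
  then show ?thesis unfolding u_def s_def by (rule power2_le_imp_le) simp
qed

text \<open>
  A bound on all oblique projections onto the orthogonal complement of \<open>{\<theta>, \<mu>}\<close> along the span of
  two elements of \<open>L\<close>.  In this form it makes sense even when the span of \<open>g\<close> and \<open>h\<close> is not a
  complement, for instance when \<open>g = h\<close>.
\<close>
definition annihilation_bound :: "real \<Rightarrow> real^'d \<Rightarrow> real^'d \<Rightarrow> (real^'d) set \<Rightarrow> bool" where
  "annihilation_bound B \<theta> \<mu> L \<longleftrightarrow>
     (\<forall>g\<in>L. \<forall>h\<in>L. \<forall>u a b. let w = u + a *\<^sub>R g + b *\<^sub>R h in
        w \<bullet> \<theta> = 0 \<longrightarrow> w \<bullet> \<mu> = 0 \<longrightarrow> norm w \<le> B * norm u)"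

lemma norm_of_annihilated_le:
  fixes w u l t :: "'a::real_inner"
  assumes "w = u + a *\<^sub>R l" and "w \<bullet> t = 0" and "l \<bullet> t = 1"
  shows "norm w \<le> norm l * norm t * norm u"
  using oblique_norm_le[OF assms(2), of l "- a"] assms(1,3) by simp

text \<open>
  The projection along \<open>g\<close> and \<open>h\<close> is done in two steps: first along \<open>g\<close> onto the complement of
  \<open>\<theta>\<close>, then along \<open>h - g\<close>, which is already orthogonal to \<open>\<theta>\<close>, onto the complement of \<open>\<mu>\<close>.
\<close>
lemma norm_of_twice_annihilated_le:
  fixes w u g h \<theta> \<mu> :: "'a::real_inner"
  assumes w: "w = u + a *\<^sub>R g + b *\<^sub>R h" and "w \<bullet> \<theta> = 0" "w \<bullet> \<mu> = 0"
    and "g \<bullet> \<theta> = 1" "h \<bullet> \<theta> = 1"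
  shows "norm w * \<bar>(h - g) \<bullet> \<mu>\<bar> \<le> norm (h - g) * norm \<mu> * (norm g * norm \<theta> * norm u)"
proof -
  define f where "f = u + (a + b) *\<^sub>R g"
  have wf: "w + (- b) *\<^sub>R (h - g) = f"
    unfolding w f_def by (simp add: algebra_simps)
  have "f \<bullet> \<theta> = 0"
    using assms unfolding wf[symmetric] by (simp add: inner_add_left inner_diff_left)
  then have "norm f \<le> norm g * norm \<theta> * norm u"
    using norm_of_annihilated_le[OF f_def] assms by simp
  moreover have "norm w * \<bar>(h - g) \<bullet> \<mu>\<bar> \<le> norm (h - g) * norm \<mu> * norm f"
    using oblique_norm_le[OF assms(3), of "h - g" "- b"] unfolding wf .
  ultimately show ?thesis
    by (meson mult_left_mono mult_nonneg_nonneg norm_ge_zero order_trans)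
qed

text \<open>
  Splits into the two kinds of pairs: for \<open>g = h\<close> the constraint by \<open>\<theta>\<close> gives the bound \<open>s\<close>, and
  for \<open>g \<noteq> h\<close> the constraint by \<open>\<mu>\<close> contributes the further factor in the last hypothesis.
\<close>
lemma annihilation_boundI:
  fixes \<theta> \<mu> :: "real^'d"
  assumes L: "\<And>g. g \<in> L \<Longrightarrow> g \<bullet> \<theta> = 1" "\<And>g. g \<in> L \<Longrightarrow> norm g * norm \<theta> \<le> s"
    and s: "s \<le> B"
    and pair: "\<And>g h. g \<in> L \<Longrightarrow> h \<in> L \<Longrightarrow> g \<noteq> h \<Longrightarrow>
      (h - g) \<bullet> \<mu> \<noteq> 0 \<and> s * norm (h - g) * norm \<mu> \<le> B * \<bar>(h - g) \<bullet> \<mu>\<bar>"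
  shows "annihilation_bound B \<theta> \<mu> L"
  unfolding annihilation_bound_def Let_def
proof (intro ballI allI impI)
  fix g h u a b
  assume gh: "g \<in> L" "h \<in> L"
    and annihilated: "(u + a *\<^sub>R g + b *\<^sub>R h) \<bullet> \<theta> = 0" "(u + a *\<^sub>R g + b *\<^sub>R h) \<bullet> \<mu> = 0"
  define w where "w = u + a *\<^sub>R g + b *\<^sub>R h"
  have w: "w \<bullet> \<theta> = 0" "w \<bullet> \<mu> = 0" using annihilated by (simp_all add: w_def)
  have "norm w \<le> B * norm u"
  proof (cases "g = h")
    case True
    have "w = u + (a + b) *\<^sub>R g" by (simp add: w_def True scaleR_add_left)
    then have "norm w \<le> norm g * norm \<theta> * norm u"
      using w(1) L(1)[OF gh(1)] by (rule norm_of_annihilated_le)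
    also have "\<dots> \<le> B * norm u" using L(2)[OF gh(1)] s by (intro mult_right_mono) auto
    finally show ?thesis .
  next
    case False
    note pair = pair[OF gh False]
    have "norm w * \<bar>(h - g) \<bullet> \<mu>\<bar> \<le> norm (h - g) * norm \<mu> * (norm g * norm \<theta> * norm u)"
      by (rule norm_of_twice_annihilated_le[OF w_def w L(1)[OF gh(1)] L(1)[OF gh(2)]])
    also have "\<dots> \<le> norm (h - g) * norm \<mu> * (s * norm u)"
      using L(2)[OF gh(1)] by (intro mult_left_mono mult_right_mono) auto
    also have "\<dots> = (s * norm (h - g) * norm \<mu>) * norm u" by simp
    also have "\<dots> \<le> (B * \<bar>(h - g) \<bullet> \<mu>\<bar>) * norm u"
      using pair by (intro mult_right_mono) auto
    finally have "norm w * \<bar>(h - g) \<bullet> \<mu>\<bar> \<le> (B * norm u) * \<bar>(h - g) \<bullet> \<mu>\<bar>"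
      by (simp add: mult_ac)
    then show ?thesis using pair by (simp add: mult_le_cancel_right)
  qed
  then show "norm (u + a *\<^sub>R g + b *\<^sub>R h) \<le> B * norm u" by (simp add: w_def)
qed

section \<open>Perturbed eigenvectors\<close>

text \<open>
  Both \<open>M y\<close> and \<open>N y\<close> are multiples of the same vector, a column of the inverse transpose of \<open>Y\<close>,
  and the multiples are the respective quadratic forms.  This is the generalised eigenvalue
  equation with the quotient of the two forms cleared.
\<close>
lemma eigen_relation_of_simultaneous_congruence:
  fixes Y M N :: "real^'n^'n" and i :: 'n
  assumes Y: "invertible Y" and M: "diagonal_matrix (congr Y M)" and N: "diagonal_matrix (congr Y N)"
  defines "y \<equiv> column i Y"
  shows "(y \<bullet> (N *v y)) *\<^sub>R (M *v y) = (y \<bullet> (M *v y)) *\<^sub>R (N *v y)"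
proof -
  let ?z = "(y \<bullet> (N *v y)) *\<^sub>R (M *v y) - (y \<bullet> (M *v y)) *\<^sub>R (N *v y)"
  have "(transpose Y *v ?z) $ p = column p Y \<bullet> ?z" for p
    by (simp add: matrix_vector_mult_def transpose_def column_def inner_vec_def)
  moreover have "column p Y \<bullet> ?z = 0" for p
  proof (cases "p = i")
    case False
    then show ?thesis using M N
      by (simp add: inner_diff_right y_def diagonal_matrix_def flip: congr_component)
  qed (simp add: inner_diff_right y_def)
  ultimately have "transpose Y *v ?z = 0" by (simp add: vec_eq_iff)
  moreover have "invertible (transpose Y)" using Y by (simp add: transpose_invertible)
  ultimately have "?z = 0"
    by (metis invertible_def matrix_vector_mul_assoc matrix_vector_mul_lid matrix_vector_mult_0_right)
  then show ?thesis by simp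
qed

lemma finite_gap:
  fixes \<rho> :: "'n::finite \<Rightarrow> real"
  shows "\<exists>\<gamma>>0. \<forall>p q. \<rho> p \<noteq> \<rho> q \<longrightarrow> \<gamma> \<le> \<bar>\<rho> p - \<rho> q\<bar>"
proof -
  let ?S = "insert 1 {\<bar>\<rho> p - \<rho> q\<bar> |p q. \<rho> p \<noteq> \<rho> q}"
  have "{\<bar>\<rho> p - \<rho> q\<bar> |p q. \<rho> p \<noteq> \<rho> q} \<subseteq> (\<lambda>(p, q). \<bar>\<rho> p - \<rho> q\<bar>) ` UNIV" by auto
  then have fin: "finite ?S" by (simp add: finite_subset)
  then have "0 < Min ?S" by (subst Min_gr_iff) auto
  moreover have "Min ?S \<le> \<bar>\<rho> p - \<rho> q\<bar>" if "\<rho> p \<noteq> \<rho> q" for p q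
    using that by (intro Min_le fin) blast
  ultimately show ?thesis by blast
qed

lemma norm_componentwise_mult_le: "norm (\<chi> p. m $ p * y $ p) \<le> norm m * norm y"
  for m y :: "real^'n"
proof -
  have "norm (\<chi> p. m $ p * y $ p) \<le> L2_set (\<lambda>p. \<bar>m $ p\<bar> * norm y) UNIV"
    unfolding norm_vec_def[of "\<chi> p. m $ p * y $ p"]
    by (intro L2_set_mono) (auto simp: abs_mult intro!: mult_left_mono component_le_norm_cart)
  also have "\<dots> = norm m * norm y"
    by (simp add: norm_vec_def[of m] L2_set_left_distrib)
  finally show ?thesis .
qed

text \<open>
  First-order perturbation of a diagonal pencil: the generalised eigenvalue \<open>r / s\<close> can be close
  to only one of the distinct ratios \<open>m p / t p\<close>, and comparing the components of the eigenvalue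
  equation shows that every component belonging to another ratio is \<open>O(\<epsilon>)\<close>.
\<close>
lemma eigenvector_localised:
  fixes t m :: "real^'n" and G F :: "real^'n^'n"
  assumes t: "\<And>p. t $ p > 0"
  defines "N \<equiv> \<lambda>\<epsilon> y. (\<chi> p. t $ p * y $ p) + \<epsilon> *\<^sub>R (G *v y)"
    and "M \<equiv> \<lambda>\<epsilon> y. (\<chi> p. m $ p * y $ p) + \<epsilon> *\<^sub>R (F *v y)"
  shows "\<exists>K>0. \<exists>\<epsilon>\<^sub>0>0. \<forall>\<epsilon> y. 0 < \<epsilon> \<longrightarrow> \<epsilon> < \<epsilon>\<^sub>0 \<longrightarrow>
           (y \<bullet> N \<epsilon> y) *\<^sub>R M \<epsilon> y = (y \<bullet> M \<epsilon> y) *\<^sub>R N \<epsilon> y \<longrightarrow>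
           (\<exists>g. \<forall>p. m $ p / t $ p \<noteq> m $ g / t $ g \<longrightarrow> \<bar>y $ p\<bar> \<le> K * \<epsilon> * norm y)"
proof -
  obtain \<gamma> where \<gamma>: "\<gamma> > 0"
    and gap: "\<And>p q. m $ p / t $ p \<noteq> m $ q / t $ q \<Longrightarrow> \<gamma> \<le> \<bar>m $ p / t $ p - m $ q / t $ q\<bar>"
    using finite_gap[of "\<lambda>p. m $ p / t $ p"] by blast
  define \<tau> where "\<tau> = Min (range (($) t))"
  have \<tau>: "\<tau> > 0" unfolding \<tau>_def using t by (subst Min_gr_iff) auto
  have t\<tau>: "t $ p \<ge> \<tau>" for p unfolding \<tau>_def by (intro Min_le) auto
  \<comment> \<open>\<open>K1\<close> bounds the first-order terms of the eigenvalue equation, and \<open>\<epsilon>\<^sub>0\<close> keeps the quadratic form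
     of the perturbed positive definite matrix above half its unperturbed value.\<close>
  define K1 where "K1 = (norm m + norm F) * norm G + (norm t + norm G) * norm F"
  have K1: "K1 \<ge> 0" unfolding K1_def by simp
  define K where "K = 4 * K1 / (\<tau>\<^sup>2 * \<gamma>) + 1"
  have K: "K > 0" unfolding K_def using K1 \<gamma> \<tau> by (simp add: add_nonneg_pos)
  define \<epsilon>\<^sub>0 where "\<epsilon>\<^sub>0 = min 1 (\<tau> / (2 * (norm G + 1)))"
  have \<epsilon>\<^sub>0: "\<epsilon>\<^sub>0 > 0" unfolding \<epsilon>\<^sub>0_def using \<tau> by (simp add: add_nonneg_pos)
  have "\<exists>g. \<forall>p. m $ p / t $ p \<noteq> m $ g / t $ g \<longrightarrow> \<bar>y $ p\<bar> \<le> K * \<epsilon> * norm y"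
    if \<epsilon>: "0 < \<epsilon>" "\<epsilon> < \<epsilon>\<^sub>0" and eq: "(y \<bullet> N \<epsilon> y) *\<^sub>R M \<epsilon> y = (y \<bullet> M \<epsilon> y) *\<^sub>R N \<epsilon> y" for \<epsilon> y
  proof (cases "y = 0")
    case False
    define s where "s = y \<bullet> N \<epsilon> y"
    define r where "r = y \<bullet> M \<epsilon> y"
    have \<epsilon>1: "\<epsilon> \<le> 1" using \<epsilon> by (simp add: \<epsilon>\<^sub>0_def)
    have yp: "norm y > 0" using False by simp
    have gen: "\<bar>y \<bullet> ((\<chi> p. c $ p * y $ p) + \<epsilon> *\<^sub>R (H *v y))\<bar> \<le> (norm c + norm H) * (norm y)\<^sup>2"
      for c :: "real^'n" and H :: "real^'n^'n"
    proof -
      have "\<epsilon> * norm (H *v y) \<le> 1 * (norm H * norm y)"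
        using \<epsilon>1 by (rule mult_mono[OF _ norm_matrix_vector_le]) auto
      then have "norm (\<epsilon> *\<^sub>R (H *v y)) \<le> norm H * norm y" using \<epsilon> by simp
      then have "norm ((\<chi> p. c $ p * y $ p) + \<epsilon> *\<^sub>R (H *v y)) \<le> norm c * norm y + norm H * norm y"
        using norm_componentwise_mult_le[of c y] by (intro norm_triangle_le) linarith
      then have "norm y * norm ((\<chi> p. c $ p * y $ p) + \<epsilon> *\<^sub>R (H *v y)) \<le> norm y * ((norm c + norm H) * norm y)"
        by (intro mult_left_mono) (simp_all add: algebra_simps)
      then show ?thesis
        using Cauchy_Schwarz_ineq2[of y "(\<chi> p. c $ p * y $ p) + \<epsilon> *\<^sub>R (H *v y)"]
        by (simp add: power2_eq_square mult_ac)
    qed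
    have r: "\<bar>r\<bar> \<le> (norm m + norm F) * (norm y)\<^sup>2" unfolding r_def M_def by (rule gen)
    have s: "\<bar>s\<bar> \<le> (norm t + norm G) * (norm y)\<^sup>2" unfolding s_def N_def by (rule gen)
    have s_low: "s \<ge> \<tau> / 2 * (norm y)\<^sup>2"
    proof -
      have "\<tau> * (norm y)\<^sup>2 = (\<Sum>p\<in>UNIV. \<tau> * (y $ p)\<^sup>2)"
        by (simp add: norm_vec_def L2_set_def sum_nonneg sum_distrib_left)
      also have "\<dots> \<le> (\<Sum>p\<in>UNIV. t $ p * (y $ p)\<^sup>2)"
        by (intro sum_mono mult_right_mono t\<tau>) simp
      also have "\<dots> = y \<bullet> (\<chi> p. t $ p * y $ p)"
        by (simp add: inner_vec_def power2_eq_square mult_ac)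
      finally have 1: "\<tau> * (norm y)\<^sup>2 \<le> y \<bullet> (\<chi> p. t $ p * y $ p)" .
      have "\<bar>y \<bullet> (G *v y)\<bar> \<le> norm y * (norm G * norm y)"
        by (rule order_trans[OF Cauchy_Schwarz_ineq2 mult_left_mono[OF norm_matrix_vector_le]]) simp
      then have "\<epsilon> * \<bar>y \<bullet> (G *v y)\<bar> \<le> \<epsilon> * ((norm G + 1) * (norm y)\<^sup>2)"
        using \<epsilon> by (intro mult_left_mono, erule_tac order_trans)
          (simp_all add: power2_eq_square algebra_simps)
      also have "\<dots> \<le> \<tau> / (2 * (norm G + 1)) * ((norm G + 1) * (norm y)\<^sup>2)"
        using \<epsilon> by (intro mult_right_mono) (auto simp: \<epsilon>\<^sub>0_def)
      also have "\<dots> = \<tau> / 2 * (norm y)\<^sup>2"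
        using norm_ge_zero[of G] by (simp add: field_simps add_nonneg_eq_0_iff)
      finally have "\<bar>\<epsilon> * (y \<bullet> (G *v y))\<bar> \<le> \<tau> / 2 * (norm y)\<^sup>2" using \<epsilon> by (simp add: abs_mult)
      with 1 show ?thesis unfolding s_def N_def by (simp add: inner_add_right abs_le_iff)
    qed
    have sp: "s > 0" using s_low \<tau> yp by (smt (verit) divide_pos_pos mult_pos_pos zero_less_power)
    define \<nu> where "\<nu> = r / s"
    have main: "\<bar>y $ p\<bar> \<le> K * \<epsilon> * norm y" if far: "\<gamma> / 2 \<le> \<bar>m $ p / t $ p - \<nu>\<bar>" for p
    proof -
      have "s * (m $ p * y $ p + \<epsilon> * (F *v y) $ p) = r * (t $ p * y $ p + \<epsilon> * (G *v y) $ p)"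
        using arg_cong[OF eq, of "\<lambda>z. z $ p"] unfolding s_def[symmetric] r_def[symmetric]
        by (simp add: M_def N_def)
      then have "(s * m $ p - r * t $ p) * y $ p = \<epsilon> * (r * (G *v y) $ p - s * (F *v y) $ p)"
        by algebra
      moreover have "s * t $ p * (m $ p / t $ p - \<nu>) = s * m $ p - r * t $ p"
        using sp t[of p] by (simp add: \<nu>_def field_simps)
      ultimately have "s * t $ p * (m $ p / t $ p - \<nu>) * y $ p
          = \<epsilon> * (r * (G *v y) $ p - s * (F *v y) $ p)"
        by simp
      then have "\<bar>s * t $ p * (m $ p / t $ p - \<nu>) * y $ p\<bar>
          = \<bar>\<epsilon> * (r * (G *v y) $ p - s * (F *v y) $ p)\<bar>"
        by (rule arg_cong)
      then have "s * t $ p * \<bar>m $ p / t $ p - \<nu>\<bar> * \<bar>y $ p\<bar>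
          = \<epsilon> * \<bar>r * (G *v y) $ p - s * (F *v y) $ p\<bar>"
        by (simp only: abs_mult abs_of_pos[OF sp] abs_of_pos[OF t] abs_of_pos[OF \<epsilon>(1)])
      also have "\<dots> \<le> \<epsilon> * (K1 * (norm y)^3)"
      proof (intro mult_left_mono)
        have comp: "\<bar>(H *v y) $ p\<bar> \<le> norm H * norm y" for H :: "real^'n^'n"
          by (rule order_trans[OF component_le_norm_cart norm_matrix_vector_le])
        have "\<bar>r * (G *v y) $ p - s * (F *v y) $ p\<bar>
            \<le> \<bar>r\<bar> * \<bar>(G *v y) $ p\<bar> + \<bar>s\<bar> * \<bar>(F *v y) $ p\<bar>"
          by (metis abs_mult abs_triangle_ineq4)
        also have "\<dots> \<le> (norm m + norm F) * (norm y)\<^sup>2 * (norm G * norm y)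
            + (norm t + norm G) * (norm y)\<^sup>2 * (norm F * norm y)"
          by (intro add_mono mult_mono r s comp) auto
        also have "\<dots> = K1 * (norm y)^3"
          by (simp add: K1_def power2_eq_square power3_eq_cube algebra_simps)
        finally show "\<bar>r * (G *v y) $ p - s * (F *v y) $ p\<bar> \<le> K1 * (norm y)^3" .
      qed (use \<epsilon> in simp)
      finally have up: "s * t $ p * \<bar>m $ p / t $ p - \<nu>\<bar> * \<bar>y $ p\<bar> \<le> \<epsilon> * (K1 * (norm y)^3)" .
      have "(\<tau> / 2 * (norm y)\<^sup>2) * \<tau> * (\<gamma> / 2) * \<bar>y $ p\<bar> \<le> s * t $ p * \<bar>m $ p / t $ p - \<nu>\<bar> * \<bar>y $ p\<bar>"
        using \<tau> \<gamma> sp t[of p] by (intro mult_mono s_low t\<tau> far order_refl) auto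
      with up have "(norm y)\<^sup>2 * (\<tau>\<^sup>2 * \<gamma> * \<bar>y $ p\<bar>) \<le> (norm y)\<^sup>2 * (4 * K1 * \<epsilon> * norm y)"
        by (simp add: power2_eq_square power3_eq_cube algebra_simps)
      then have "\<tau>\<^sup>2 * \<gamma> * \<bar>y $ p\<bar> \<le> 4 * K1 * \<epsilon> * norm y" using yp by simp
      then have "\<bar>y $ p\<bar> \<le> 4 * K1 / (\<tau>\<^sup>2 * \<gamma>) * \<epsilon> * norm y"
        using \<tau> \<gamma> by (simp add: field_simps)
      also have "\<dots> \<le> K * \<epsilon> * norm y" using \<epsilon> by (intro mult_right_mono) (auto simp: K_def)
      finally show ?thesis .
    qed
    show ?thesis
    proof (cases "\<exists>g. \<bar>m $ g / t $ g - \<nu>\<bar> < \<gamma> / 2")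
      case True
      then obtain g where g: "\<bar>m $ g / t $ g - \<nu>\<bar> < \<gamma> / 2" by blast
      have "\<bar>y $ p\<bar> \<le> K * \<epsilon> * norm y" if "m $ p / t $ p \<noteq> m $ g / t $ g" for p
        using gap[OF that] g by (intro main) linarith
      then show ?thesis by blast
    next
      case False
      then show ?thesis using main by (metis linorder_not_less)
    qed
  qed simp
  then show ?thesis using K \<epsilon>\<^sub>0 by blast
qed

section \<open>The deterministic off-diagonal estimate\<close>

text \<open>
  Components outside the two groups are small in both \<open>y\<close> and \<open>z\<close>, hence contribute a product of two
  small factors; the two groups contribute multiples of their own direction, and these
  multiples do not enter the annihilation bound.
\<close>
lemma pair_estimate:
  fixes v :: "'n::finite \<Rightarrow> real^'d" and y z :: "real^'n" and \<theta> \<mu> u w :: "real^'d"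
  defines "\<kappa> \<equiv> \<lambda>p. v p /\<^sub>R (v p \<bullet> \<theta>)"
  assumes pos: "\<And>p. v p \<bullet> \<theta> > 0"
    and bound: "annihilation_bound B \<theta> \<mu> (range \<kappa>)" and B: "B \<ge> 0"
    and w: "w = (\<Sum>p\<in>UNIV. (y $ p * z $ p) *\<^sub>R v p) + u"
    and annihilated: "w \<bullet> \<theta> = 0" "w \<bullet> \<mu> = 0"
    and y: "\<And>p. \<kappa> p \<noteq> \<kappa> g \<Longrightarrow> \<bar>y $ p\<bar> \<le> a"
    and z: "\<And>p. \<kappa> p \<noteq> \<kappa> h \<Longrightarrow> \<bar>z $ p\<bar> \<le> b"
    and a: "a \<ge> 0" and b: "b \<ge> 0"
  shows "norm w \<le> B * (norm u + a * b * (\<Sum>p\<in>UNIV. norm (v p)))"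
proof -
  define f where "f = (\<lambda>p. (y $ p * z $ p) *\<^sub>R v p)"
  define c where "c = (\<lambda>p. y $ p * z $ p * (v p \<bullet> \<theta>))"
  \<comment> \<open>The group of \<open>h\<close> is taken without that of \<open>g\<close>, so that the two stay disjoint if they coincide.\<close>
  define S where "S = {p. \<kappa> p = \<kappa> g}"
  define T where "T = {p. \<kappa> p = \<kappa> h \<and> \<kappa> p \<noteq> \<kappa> g}"
  define r where "r = (\<Sum>p\<in>-(S \<union> T). f p)"
  have f: "f p = c p *\<^sub>R \<kappa> p" for p
    using pos[of p] by (simp add: f_def c_def \<kappa>_def)
  have "(\<Sum>p\<in>UNIV. f p) = (\<Sum>p\<in>S \<union> T. f p) + r"
    unfolding r_def using sum.subset_diff[of "S \<union> T" UNIV f]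
    by (simp only: Compl_eq_Diff_UNIV finite_code subset_UNIV add.commute)
  also have "(\<Sum>p\<in>S \<union> T. f p) = (\<Sum>p\<in>S. f p) + (\<Sum>p\<in>T. f p)"
    by (rule sum.union_disjoint) (auto simp: S_def T_def)
  also have "(\<Sum>p\<in>S. f p) = (\<Sum>p\<in>S. c p) *\<^sub>R \<kappa> g"
    unfolding scaleR_sum_left by (rule sum.cong) (auto simp: f S_def)
  also have "(\<Sum>p\<in>T. f p) = (\<Sum>p\<in>T. c p) *\<^sub>R \<kappa> h"
    unfolding scaleR_sum_left by (rule sum.cong) (auto simp: f T_def)
  finally have "w = (u + r) + (\<Sum>p\<in>S. c p) *\<^sub>R \<kappa> g + (\<Sum>p\<in>T. c p) *\<^sub>R \<kappa> h"
    unfolding w f_def by (simp add: algebra_simps)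
  then have w_le: "norm w \<le> B * norm (u + r)"
    using bound annihilated unfolding annihilation_bound_def Let_def by blast
  have "norm r \<le> a * b * (\<Sum>p\<in>UNIV. norm (v p))"
  proof -
    have "norm r \<le> (\<Sum>p\<in>-(S \<union> T). norm (f p))" unfolding r_def by (rule norm_sum)
    also have "\<dots> \<le> (\<Sum>p\<in>-(S \<union> T). a * b * norm (v p))"
    proof (rule sum_mono)
      fix p assume "p \<in> -(S \<union> T)"
      then have "\<kappa> p \<noteq> \<kappa> g" "\<kappa> p \<noteq> \<kappa> h" by (auto simp: S_def T_def)
      then have "\<bar>y $ p\<bar> * \<bar>z $ p\<bar> \<le> a * b" using y z a by (intro mult_mono) auto
      then show "norm (f p) \<le> a * b * norm (v p)"
        by (simp add: f_def abs_mult mult_right_mono)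
    qed
    also have "\<dots> \<le> a * b * (\<Sum>p\<in>UNIV. norm (v p))"
      unfolding sum_distrib_left using a b by (intro sum_mono2) auto
    finally show ?thesis .
  qed
  then have "B * norm (u + r) \<le> B * (norm u + a * b * (\<Sum>p\<in>UNIV. norm (v p)))"
    using B norm_triangle_ineq[of u r] by (intro mult_left_mono) linarith+
  with w_le show ?thesis by linarith
qed

text \<open>
  The deterministic half of the theorem.  Exact diagonality places the entry vectors \<open>w i j\<close> in the
  orthogonal complement of \<open>{\<theta>, \<mu>}\<close>, and localisation of the columns places them near
  \<open>\<epsilon> *\<^sub>R e i j\<close> plus the span of two eigenvalue vectors.  Both error terms scale like the product of
  the norms of two columns, which is why the final constant is uniform in \<open>X\<close>.
\<close>
theorem perturbed_offdiag_bound: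
  fixes A E :: "'d::finite \<Rightarrow> real^'n^'n" and X\<^sub>0 :: "real^'n^'n" and \<theta> \<mu> :: "real^'d"
  defines "v \<equiv> \<lambda>p. \<chi> k. congr X\<^sub>0 (A k) $ p $ p"
  defines "\<kappa> \<equiv> \<lambda>p. v p /\<^sub>R (v p \<bullet> \<theta>)"
  assumes X\<^sub>0: "diagonalizes X\<^sub>0 A"
    and pos: "\<And>p. v p \<bullet> \<theta> > 0"
    and E_norm: "(\<Sum>k\<in>UNIV. (frobenius_norm (E k))\<^sup>2) = 1"
    and bound: "annihilation_bound B \<theta> \<mu> (range \<kappa>)" and B: "B \<ge> 0"
    and sep: "\<And>p q. \<kappa> p \<noteq> \<kappa> q \<Longrightarrow> \<kappa> p \<bullet> \<mu> \<noteq> \<kappa> q \<bullet> \<mu>"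
  shows "\<exists>C. \<forall>\<^sub>F \<epsilon> in at_right 0. \<forall>X.
           (let A' = (\<lambda>k. A k + \<epsilon> *\<^sub>R E k) in
             invertible X \<and>
             diagonal_matrix (congr X (lincomb A' \<mu>)) \<and>
             diagonal_matrix (congr X (lincomb A' \<theta>)) \<longrightarrow>
             1 / (spectral_norm X)\<^sup>2 *
                 sqrt (\<Sum>k\<in>UNIV. (frobenius_norm (offdiag (congr X (A' k))))\<^sup>2)
               \<le> B * \<epsilon> + C * \<epsilon>\<^sup>2)"
proof -
  define F where "F = (\<lambda>k. congr X\<^sub>0 (E k))"
  define t m where "t = (\<chi> p. v p \<bullet> \<theta>)" and "m = (\<chi> p. v p \<bullet> \<mu>)"
  have ratio: "m $ p / t $ p = \<kappa> p \<bullet> \<mu>" for p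
    by (simp add: m_def t_def \<kappa>_def divide_inverse mult.commute)
  have "t $ p > 0" for p using pos by (simp add: t_def)
  from eigenvector_localised[OF this, where m = m and G = "lincomb F \<theta>" and F = "lincomb F \<mu>"]
  obtain K \<epsilon>\<^sub>0 where K: "K > 0" and \<epsilon>\<^sub>0: "\<epsilon>\<^sub>0 > 0" and local:
    "\<And>\<epsilon> y. 0 < \<epsilon> \<Longrightarrow> \<epsilon> < \<epsilon>\<^sub>0 \<Longrightarrow>
       (y \<bullet> ((\<chi> p. t $ p * y $ p) + \<epsilon> *\<^sub>R (lincomb F \<theta> *v y))) *\<^sub>R ((\<chi> p. m $ p * y $ p) + \<epsilon> *\<^sub>R (lincomb F \<mu> *v y))
       = (y \<bullet> ((\<chi> p. m $ p * y $ p) + \<epsilon> *\<^sub>R (lincomb F \<mu> *v y))) *\<^sub>R ((\<chi> p. t $ p * y $ p) + \<epsilon> *\<^sub>R (lincomb F \<theta> *v y)) \<Longrightarrow>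
       \<exists>g. \<forall>p. m $ p / t $ p \<noteq> m $ g / t $ g \<longrightarrow> \<bar>y $ p\<bar> \<le> K * \<epsilon> * norm y" by blast
  have diag: "diagonal_matrix (congr X\<^sub>0 (A k))" for k using X\<^sub>0 by (simp add: diagonalizes_def)
  have diag_lin: "congr X\<^sub>0 (lincomb A \<xi>) *v y = (\<chi> p. (v p \<bullet> \<xi>) * y $ p)" for \<xi> y
  proof -
    have "diagonal_matrix (congr X\<^sub>0 (lincomb A \<xi>))"
      using diag by (simp add: diagonal_matrix_def congr_lincomb_component inner_vec_def)
    then show ?thesis
      by (simp add: diagonal_matrix_mult_vector congr_lincomb_component v_def)
  qed
  have pert: "congr X\<^sub>0 (lincomb (\<lambda>k. A k + \<epsilon> *\<^sub>R E k) \<xi>) *v y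
      = (\<chi> p. (v p \<bullet> \<xi>) * y $ p) + \<epsilon> *\<^sub>R (lincomb F \<xi> *v y)" for \<epsilon> \<xi> y
    unfolding lincomb_perturbed congr_add_scaleR F_def lincomb_congr[symmetric]
    by (simp add: matrix_vector_mult_add_rdistrib diag_lin scaleR_matrix_vector_assoc)
  obtain X\<^sub>0' where X\<^sub>0': "X\<^sub>0 ** X\<^sub>0' = mat 1" "X\<^sub>0' ** X\<^sub>0 = mat 1"
    using X\<^sub>0 by (auto simp: diagonalizes_def invertible_def)
  define V where "V = (\<Sum>p\<in>UNIV. norm (v p))"
  define C where "C = B * K\<^sup>2 * V * (norm X\<^sub>0')\<^sup>2"
  have V: "V \<ge> 0" unfolding V_def by (simp add: sum_nonneg)
  have "1 / (spectral_norm X)\<^sup>2 * sqrt (\<Sum>k\<in>UNIV. (frobenius_norm (offdiag (congr X (A' k))))\<^sup>2)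
      \<le> B * \<epsilon> + C * \<epsilon>\<^sup>2"
    if \<epsilon>: "0 < \<epsilon>" "\<epsilon> < \<epsilon>\<^sub>0" and A': "A' = (\<lambda>k. A k + \<epsilon> *\<^sub>R E k)" and X: "invertible X"
      and D\<mu>: "diagonal_matrix (congr X (lincomb A' \<mu>))" and D\<theta>: "diagonal_matrix (congr X (lincomb A' \<theta>))"
    for \<epsilon> A' X
  proof -
    define Y where "Y = X\<^sub>0' ** X"
    have XY: "X\<^sub>0 ** Y = X" by (simp add: Y_def matrix_mul_assoc X\<^sub>0')
    have Y: "invertible Y"
      unfolding Y_def using X X\<^sub>0' by (intro invertible_mult) (auto simp: invertible_def)
    have congrY: "congr Y (congr X\<^sub>0 Q) = congr X Q" for Q by (simp add: congr_congr XY)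
    define w e where "w = (\<lambda>i j. \<chi> k. congr X (A' k) $ i $ j)" and "e = (\<lambda>i j. \<chi> k. congr X (E k) $ i $ j)"
    let ?y = "\<lambda>i. column i Y"
    have loc: "\<exists>g. \<forall>p. \<kappa> p \<noteq> \<kappa> g \<longrightarrow> \<bar>?y i $ p\<bar> \<le> K * \<epsilon> * norm (?y i)" for i
    proof -
      have eq: "(?y i \<bullet> (congr X\<^sub>0 (lincomb A' \<theta>) *v ?y i)) *\<^sub>R (congr X\<^sub>0 (lincomb A' \<mu>) *v ?y i)
        = (?y i \<bullet> (congr X\<^sub>0 (lincomb A' \<mu>) *v ?y i)) *\<^sub>R (congr X\<^sub>0 (lincomb A' \<theta>) *v ?y i)"
        using eigen_relation_of_simultaneous_congruence[OF Y] D\<mu> D\<theta> by (simp add: congrY)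
      then obtain g where "\<forall>p. m $ p / t $ p \<noteq> m $ g / t $ g \<longrightarrow> \<bar>?y i $ p\<bar> \<le> K * \<epsilon> * norm (?y i)"
        using local[OF \<epsilon>, of "?y i"] unfolding A' pert by (auto simp: t_def m_def)
      then show ?thesis using sep unfolding ratio by blast
    qed
    have w_eq: "w i j = (\<Sum>p\<in>UNIV. (?y i $ p * ?y j $ p) *\<^sub>R v p) + \<epsilon> *\<^sub>R e i j" for i j
    proof -
      have "congr X (A k) $ i $ j = (\<Sum>p\<in>UNIV. ?y i $ p * ?y j $ p * v p $ k)" for k
        unfolding congrY[symmetric] congr_component[of Y] diagonal_matrix_mult_vector[OF diag]
        by (simp add: inner_vec_def v_def mult_ac)
      then show ?thesis
        by (simp add: vec_eq_iff w_def e_def A' congr_add_scaleR)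
    qed
    have w_le: "norm (w i j) \<le> B * \<epsilon> * norm (e i j) + B * K\<^sup>2 * V * \<epsilon>\<^sup>2 * (norm (?y i) * norm (?y j))"
      if "i \<noteq> j" for i j
    proof -
      obtain g where g: "\<And>p. \<kappa> p \<noteq> \<kappa> g \<Longrightarrow> \<bar>?y i $ p\<bar> \<le> K * \<epsilon> * norm (?y i)" using loc by blast
      obtain h where h: "\<And>p. \<kappa> p \<noteq> \<kappa> h \<Longrightarrow> \<bar>?y j $ p\<bar> \<le> K * \<epsilon> * norm (?y j)" using loc by blast
      have "w i j \<bullet> \<theta> = 0" "w i j \<bullet> \<mu> = 0"
        using D\<mu> D\<theta> that by (simp_all add: w_def congr_lincomb_component diagonal_matrix_def)
      from pair_estimate[OF pos bound[unfolded \<kappa>_def] B w_eq this g[unfolded \<kappa>_def] h[unfolded \<kappa>_def]]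
      have "norm (w i j) \<le> B * (norm (\<epsilon> *\<^sub>R e i j) + K * \<epsilon> * norm (?y i) * (K * \<epsilon> * norm (?y j)) * V)"
        using K \<epsilon> unfolding V_def by simp
      then show ?thesis using \<epsilon> by (simp add: power2_eq_square algebra_simps)
    qed
    let ?s = "spectral_norm X"
    have s: "?s > 0" using X by (rule spectral_norm_pos)
    let ?e = "\<lambda>ij. norm (e (fst ij) (snd ij))" and ?yy = "\<lambda>ij. norm (?y (fst ij)) * norm (?y (snd ij))"
    have e_sum: "L2_set ?e UNIV \<le> ?s\<^sup>2"
    proof -
      have "(\<Sum>ij\<in>UNIV. (?e ij)\<^sup>2) = (\<Sum>k\<in>UNIV. (norm (congr X (E k)))\<^sup>2)"
        unfolding sum_norm_power2_eq e_def by (simp add: case_prod_beta)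
      also have "\<dots> \<le> (\<Sum>k\<in>UNIV. (?s\<^sup>2 * norm (E k))\<^sup>2)"
        by (intro sum_mono power_mono norm_congr_le) simp
      also have "\<dots> = (?s\<^sup>2)\<^sup>2"
        using E_norm by (simp add: power_mult_distrib frobenius_norm_eq_norm flip: sum_distrib_left)
      finally show ?thesis unfolding L2_set_def by (rule real_le_lsqrt[rotated 1]) simp
    qed
    have y_sum: "L2_set ?yy UNIV \<le> (?s * norm X\<^sub>0')\<^sup>2"
    proof -
      have "(\<Sum>ij\<in>UNIV. (?yy ij)\<^sup>2) = (\<Sum>(i,j)\<in>UNIV\<times>UNIV. (norm (?y i))\<^sup>2 * (norm (?y j))\<^sup>2)"
        by (simp add: case_prod_beta power_mult_distrib)
      also have "\<dots> = (\<Sum>i\<in>UNIV. (norm (?y i))\<^sup>2) * (\<Sum>j\<in>UNIV. (norm (?y j))\<^sup>2)"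
        unfolding sum.cartesian_product[symmetric] by (rule sum_product[symmetric])
      also have "\<dots> = ((norm Y)\<^sup>2)\<^sup>2"
        by (simp only: norm_power2_eq_sum_columns[symmetric] power2_eq_square[of "(norm Y)\<^sup>2"])
      finally have "L2_set ?yy UNIV = (norm Y)\<^sup>2"
        unfolding L2_set_def by (simp only: real_sqrt_abs abs_power2)
      also have "\<dots> \<le> (?s * norm X\<^sub>0')\<^sup>2"
        unfolding Y_def by (intro power_mono norm_matrix_mult_le_spectral_norm) simp
      finally show ?thesis .
    qed
    have "sqrt (\<Sum>k\<in>UNIV. (frobenius_norm (offdiag (congr X (A' k))))\<^sup>2)
        = L2_set (\<lambda>ij. norm (\<chi> k. offdiag (congr X (A' k)) $ fst ij $ snd ij)) UNIV"
      unfolding frobenius_norm_eq_norm sum_norm_power2_eq by (simp add: L2_set_def case_prod_beta)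
    also have "\<dots> \<le> L2_set (\<lambda>ij. B * \<epsilon> * ?e ij + B * K\<^sup>2 * V * \<epsilon>\<^sup>2 * ?yy ij) UNIV"
    proof (rule L2_set_mono)
      fix ij :: "'n \<times> 'n"
      obtain i j where ij: "ij = (i, j)" by (cases ij)
      show "norm (\<chi> k. offdiag (congr X (A' k)) $ fst ij $ snd ij)
        \<le> B * \<epsilon> * ?e ij + B * K\<^sup>2 * V * \<epsilon>\<^sup>2 * ?yy ij"
      proof (cases "i = j")
        case True
        then show ?thesis using B \<epsilon> V by (simp add: ij offdiag_def zero_vec_def[symmetric])
      next
        case False
        then show ?thesis using w_le[OF False] by (simp add: ij offdiag_def w_def)
      qed
    qed simp
    also have "\<dots> \<le> L2_set (\<lambda>ij. B * \<epsilon> * ?e ij) UNIV + L2_set (\<lambda>ij. B * K\<^sup>2 * V * \<epsilon>\<^sup>2 * ?yy ij) UNIV"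
      by (rule L2_set_triangle_ineq)
    also have "\<dots> = B * \<epsilon> * L2_set ?e UNIV + B * K\<^sup>2 * V * \<epsilon>\<^sup>2 * L2_set ?yy UNIV"
      using B V \<epsilon> by (simp add: L2_set_right_distrib)
    also have "\<dots> \<le> B * \<epsilon> * ?s\<^sup>2 + B * K\<^sup>2 * V * \<epsilon>\<^sup>2 * (?s * norm X\<^sub>0')\<^sup>2"
      using B V \<epsilon> by (intro add_mono mult_left_mono e_sum y_sum) auto
    also have "\<dots> = ?s\<^sup>2 * (B * \<epsilon> + C * \<epsilon>\<^sup>2)"
      by (simp add: C_def power_mult_distrib algebra_simps)
    finally have "sqrt (\<Sum>k\<in>UNIV. (frobenius_norm (offdiag (congr X (A' k))))\<^sup>2)
        \<le> ?s\<^sup>2 * (B * \<epsilon> + C * \<epsilon>\<^sup>2)" .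
    then show ?thesis using s by (simp add: divide_le_eq mult.commute)
  qed
  then have "\<forall>\<^sub>F \<epsilon> in at_right 0. \<forall>X.
           (let A' = (\<lambda>k. A k + \<epsilon> *\<^sub>R E k) in
             invertible X \<and>
             diagonal_matrix (congr X (lincomb A' \<mu>)) \<and>
             diagonal_matrix (congr X (lincomb A' \<theta>)) \<longrightarrow>
             1 / (spectral_norm X)\<^sup>2 *
                 sqrt (\<Sum>k\<in>UNIV. (frobenius_norm (offdiag (congr X (A' k))))\<^sup>2)
               \<le> B * \<epsilon> + C * \<epsilon>\<^sup>2)"
    unfolding eventually_at_right_field Let_def using \<epsilon>\<^sub>0 by blast
  then show ?thesis by blast
qed

section \<open>Measurability of the estimate\<close>

lemma spectral_norm_le_add: "spectral_norm X \<le> spectral_norm Y + norm (X - Y)"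
  unfolding spectral_norm_def[of X]
proof (rule onorm_bound)
  fix x
  have "X *v x = Y *v x + (X - Y) *v x" by (simp flip: matrix_vector_mult_add_rdistrib)
  then show "norm (X *v x) \<le> (spectral_norm Y + norm (X - Y)) * norm x"
    using norm_triangle_ineq[of "Y *v x" "(X - Y) *v x"] norm_mult_le_spectral_norm[of Y x]
      norm_matrix_vector_le[of "X - Y" x] by (simp add: distrib_right)
qed (simp add: spectral_norm_nonneg)

lemma continuous_on_spectral_norm: "continuous_on UNIV (spectral_norm :: real^'n^'n \<Rightarrow> real)"
proof (rule lipschitz_on_continuous_on[OF lipschitz_onI[of _ _ 1]])
  fix X Y :: "real^'n^'n"
  show "dist (spectral_norm X) (spectral_norm Y) \<le> 1 * dist X Y"
    using spectral_norm_le_add[of X Y] spectral_norm_le_add[of Y X]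
    by (simp add: dist_real_def dist_norm norm_minus_commute abs_le_iff)
qed simp

text \<open>
  A projection of a Borel set is in general only analytic.  Here the set is \<open>\<sigma>\<close>-compact, and
  continuous images preserve this.
\<close>
lemma fst_image_open_inter_closed_borel:
  fixes U K :: "('a::euclidean_space \<times> 'b::euclidean_space) set"
  assumes "open U" "closed K"
  shows "fst ` (U \<inter> K) \<in> sets borel"
proof -
  obtain S where S: "\<And>n::nat. compact (S n)" and U: "\<Union>(range S) = U"
    using open_Union_compact_subsets[OF \<open>open U\<close>] by metis
  have "fst ` (U \<inter> K) = (\<Union>n. fst ` (S n \<inter> K))" by (auto simp flip: U)
  moreover have "compact (fst ` (S n \<inter> K))" for n
    using S \<open>closed K\<close> by (intro compact_continuous_image continuous_intros) auto
  ultimately show ?thesis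
    by (simp only:) (intro sets.countable_UN image_subsetI borel_compact)
qed

lemma continuous_on_congr_lincomb_perturbed:
  fixes A E :: "'d::finite \<Rightarrow> real^'n^'n"
  assumes "continuous_on S f" "continuous_on S g" "continuous_on S h"
  shows "continuous_on S (\<lambda>x. congr (h x) (lincomb (\<lambda>k. A k + g x *\<^sub>R E k) (f x)))"
  unfolding congr_def lincomb_def matrix_matrix_mult_def transpose_def
  by (intro continuous_intros assms continuous_on_vec_lambda continuous_on_component)

lemma continuous_on_congr_perturbed:
  fixes A E :: "real^'n^'n"
  assumes "continuous_on S g" "continuous_on S h"
  shows "continuous_on S (\<lambda>x. congr (h x) (A + g x *\<^sub>R E))"
  unfolding congr_def matrix_matrix_mult_def transpose_def
  by (intro continuous_intros assms continuous_on_vec_lambda continuous_on_component)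

lemma continuous_on_offdiag:
  assumes "continuous_on S f"
  shows "continuous_on S (\<lambda>x. offdiag (f x :: real^'n^'n))"
proof -
  have "continuous_on S (\<lambda>x. if i = j then 0 else f x $ i $ j)" for i j
    by (cases "i = j") (auto intro!: continuous_intros continuous_on_component assms)
  then show ?thesis unfolding offdiag_def by (intro continuous_on_vec_lambda)
qed

lemma continuous_on_det: "continuous_on UNIV (det :: real^'n^'n \<Rightarrow> real)"
  unfolding det_def by (intro continuous_intros continuous_on_component)

lemma closed_diagonal_matrix: "closed {M :: real^'n^'n. diagonal_matrix M}"
  unfolding diagonal_matrix_def
  by (intro closed_Collect_all closed_Collect_imp open_Collect_const closed_Collect_eq
      continuous_intros continuous_on_component)

text \<open>
  The constant \<open>C\<close> may be taken from the naturals and the range of \<open>\<epsilon>\<close> from the intervals below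
  \<open>1 / (N + 1)\<close>.  For fixed \<open>C\<close> and \<open>N\<close> the set of \<open>\<mu>\<close> with a counterexample \<open>(\<epsilon>, X)\<close> is a projection
  of the intersection of an open set (invertibility and the strict reverse inequality) with a
  closed one (diagonality), so it is Borel.
\<close>
lemma perturbation_estimate_borel:
  fixes A E :: "'d::finite \<Rightarrow> real^'n^'n" and \<theta> :: "real^'d" and B :: real
  shows "{\<mu>. \<exists>C. \<forall>\<^sub>F \<epsilon> in at_right 0. \<forall>X.
           (let A' = (\<lambda>k. A k + \<epsilon> *\<^sub>R E k) in
             invertible X \<and>
             diagonal_matrix (congr X (lincomb A' \<mu>)) \<and>
             diagonal_matrix (congr X (lincomb A' \<theta>)) \<longrightarrow>
             1 / (spectral_norm X)\<^sup>2 *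
                 sqrt (\<Sum>k\<in>UNIV. (frobenius_norm (offdiag (congr X (A' k))))\<^sup>2)
               \<le> B * \<epsilon> + C * \<epsilon>\<^sup>2)} \<in> sets borel" (is "?G \<in> _")
proof -
  define lhs where "lhs = (\<lambda>\<epsilon> X. sqrt (\<Sum>k\<in>UNIV. (norm (offdiag (congr X (A k + \<epsilon> *\<^sub>R E k))))\<^sup>2))"
  define adm where "adm = (\<lambda>\<mu> \<epsilon> X.
      diagonal_matrix (congr X (lincomb (\<lambda>k. A k + \<epsilon> *\<^sub>R E k) \<mu>)) \<and>
      diagonal_matrix (congr X (lincomb (\<lambda>k. A k + \<epsilon> *\<^sub>R E k) \<theta>)))"
  \<comment> \<open>Multiplying by the squared spectral norm removes the quotient, which is discontinuous at zero.\<close>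
  define U :: "real \<Rightarrow> real \<Rightarrow> ((real^'d) \<times> real \<times> (real^'n^'n)) set" where
    "U = (\<lambda>C \<delta>. {x. 0 < fst (snd x)} \<inter> {x. fst (snd x) < \<delta>} \<inter> {x. det (snd (snd x)) \<noteq> 0} \<inter>
      {x. (B * fst (snd x) + C * (fst (snd x))\<^sup>2) * (spectral_norm (snd (snd x)))\<^sup>2 < lhs (fst (snd x)) (snd (snd x))})"
  define K :: "((real^'d) \<times> real \<times> (real^'n^'n)) set" where
    "K = {x. adm (fst x) (fst (snd x)) (snd (snd x))}"
  have cont: "continuous_on UNIV (\<lambda>x::(real^'d) \<times> real \<times> (real^'n^'n). lhs (fst (snd x)) (snd (snd x)))"
    unfolding lhs_def
    by (intro continuous_intros continuous_on_offdiag continuous_on_congr_perturbed)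
  have U: "open (U C \<delta>)" for C \<delta>
    unfolding U_def
    by (intro open_Int open_Collect_less open_Collect_neq continuous_intros cont
        continuous_on_compose2[OF continuous_on_spectral_norm]
        continuous_on_compose2[OF continuous_on_det]) auto
  have K: "closed K"
  proof -
    have "closed ((\<lambda>x. congr (h x) (lincomb (\<lambda>k. A k + g x *\<^sub>R E k) (f x))) -` {M. diagonal_matrix M})"
      if "continuous_on UNIV f" "continuous_on UNIV g" "continuous_on UNIV h"
      for f :: "(real^'d) \<times> real \<times> (real^'n^'n) \<Rightarrow> real^'d" and g h
      using that by (intro closed_vimage closed_diagonal_matrix continuous_on_congr_lincomb_perturbed)
    note closed_constraint = this
    have "closed {x :: (real^'d) \<times> real \<times> (real^'n^'n).
        diagonal_matrix (congr (snd (snd x)) (lincomb (\<lambda>k. A k + fst (snd x) *\<^sub>R E k) (fst x)))}"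
      using closed_constraint[of fst "\<lambda>x. fst (snd x)" "\<lambda>x. snd (snd x)"]
      by (simp add: vimage_def continuous_on_fst continuous_on_snd continuous_on_id)
    moreover have "closed {x :: (real^'d) \<times> real \<times> (real^'n^'n).
        diagonal_matrix (congr (snd (snd x)) (lincomb (\<lambda>k. A k + fst (snd x) *\<^sub>R E k) \<theta>))}"
      using closed_constraint[of "\<lambda>x. \<theta>" "\<lambda>x. fst (snd x)" "\<lambda>x. snd (snd x)"]
      by (simp add: vimage_def continuous_on_fst continuous_on_snd continuous_on_id)
    ultimately have "closed ({x. diagonal_matrix (congr (snd (snd x)) (lincomb (\<lambda>k. A k + fst (snd x) *\<^sub>R E k) (fst x)))}
      \<inter> {x :: (real^'d) \<times> real \<times> (real^'n^'n). diagonal_matrix (congr (snd (snd x)) (lincomb (\<lambda>k. A k + fst (snd x) *\<^sub>R E k) \<theta>))})"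
      by (rule closed_Int)
    then show ?thesis unfolding K_def adm_def by (simp add: Collect_conj_eq)
  qed
  have "?G = (\<Union>C::nat. \<Union>N::nat. - fst ` (U (real C) (1 / (real N + 1)) \<inter> K))"
  proof -
    have ineq: "1 / (spectral_norm X)\<^sup>2 * lhs \<epsilon> X \<le> b \<longleftrightarrow> \<not> b * (spectral_norm X)\<^sup>2 < lhs \<epsilon> X"
      if "det X \<noteq> 0" for X :: "real^'n^'n" and \<epsilon> b
      using spectral_norm_pos[of X] that by (simp add: invertible_det_nz divide_le_eq not_less)
    have mem: "\<mu> \<in> - fst ` (U C \<delta> \<inter> K) \<longleftrightarrow> (\<forall>\<epsilon>. 0 < \<epsilon> \<longrightarrow> \<epsilon> < \<delta> \<longrightarrow> (\<forall>X. det X \<noteq> 0 \<longrightarrow> adm \<mu> \<epsilon> X \<longrightarrow>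
        1 / (spectral_norm X)\<^sup>2 * lhs \<epsilon> X \<le> B * \<epsilon> + C * \<epsilon>\<^sup>2))" for \<mu> C \<delta>
    proof -
      have img: "\<mu> \<in> fst ` S \<longleftrightarrow> (\<exists>\<epsilon> X. (\<mu>, \<epsilon>, X) \<in> S)" for S :: "((real^'d) \<times> real \<times> (real^'n^'n)) set"
        by (force simp: image_iff)
      have inU: "(\<mu>, \<epsilon>, X) \<in> U C \<delta> \<inter> K \<longleftrightarrow> 0 < \<epsilon> \<and> \<epsilon> < \<delta> \<and> det X \<noteq> 0 \<and>
          (B * \<epsilon> + C * \<epsilon>\<^sup>2) * (spectral_norm X)\<^sup>2 < lhs \<epsilon> X \<and> adm \<mu> \<epsilon> X" for \<epsilon> X
        by (simp add: U_def K_def)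
      show ?thesis unfolding Compl_iff img inU using ineq by blast
    qed
    have G: "\<mu> \<in> ?G \<longleftrightarrow> (\<exists>C. \<exists>\<delta>>0. \<mu> \<in> - fst ` (U C \<delta> \<inter> K))" for \<mu>
      unfolding mem mem_Collect_eq eventually_at_right_field Let_def frobenius_norm_eq_norm
        invertible_det_nz lhs_def adm_def by blast
    have mono: "\<mu> \<in> - fst ` (U C' \<delta>' \<inter> K)" if "\<mu> \<in> - fst ` (U C \<delta> \<inter> K)" "C \<le> C'" "\<delta>' \<le> \<delta>" for \<mu> C C' \<delta> \<delta>'
      unfolding mem
    proof (intro allI impI)
      fix \<epsilon> :: real and X :: "real^'n^'n" assume *: "0 < \<epsilon>" "\<epsilon> < \<delta>'" "det X \<noteq> 0" "adm \<mu> \<epsilon> X"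
      have "1 / (spectral_norm X)\<^sup>2 * lhs \<epsilon> X \<le> B * \<epsilon> + C * \<epsilon>\<^sup>2"
        using that * unfolding mem by auto
      also have "\<dots> \<le> B * \<epsilon> + C' * \<epsilon>\<^sup>2" using that by (simp add: mult_right_mono)
      finally show "1 / (spectral_norm X)\<^sup>2 * lhs \<epsilon> X \<le> B * \<epsilon> + C' * \<epsilon>\<^sup>2" .
    qed
    show ?thesis
    proof (intro set_eqI iffI)
      fix \<mu> assume "\<mu> \<in> ?G"
      then obtain C \<delta> where C: "\<delta> > 0" "\<mu> \<in> - fst ` (U C \<delta> \<inter> K)" unfolding G by blast
      obtain C' :: nat where "C \<le> real C'" using real_arch_simple by blast
      moreover obtain N :: nat where "1 / (real N + 1) < \<delta>"
        using C(1) by (metis nat_approx_posE of_nat_Suc add.commute)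
      ultimately show "\<mu> \<in> (\<Union>C::nat. \<Union>N::nat. - fst ` (U (real C) (1 / (real N + 1)) \<inter> K))"
        using mono[OF C(2)] by (meson UN_iff UNIV_I less_imp_le)
    next
      fix \<mu> assume "\<mu> \<in> (\<Union>C::nat. \<Union>N::nat. - fst ` (U (real C) (1 / (real N + 1)) \<inter> K))"
      then obtain C N :: nat where "\<mu> \<in> - fst ` (U (real C) (1 / (real N + 1)) \<inter> K)" by blast
      moreover have "1 / (real N + 1) > 0" by simp
      ultimately show "\<mu> \<in> ?G" unfolding G by blast
    qed
  qed
  also have "\<dots> \<in> sets borel"
    by (intro sets.countable_UN image_subsetI borel_comp fst_image_open_inter_closed_borel U K)
  finally show ?thesis .
qed

section \<open>Small values of Gaussian linear forms\<close>

lemma std_normal_density_le: "std_normal_density x \<le> 1 / sqrt (2 * pi)"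
  by (simp add: normal_density_def divide_right_mono)

text \<open>
  Conditionally on \<open>U\<close>, the variable \<open>Z\<close> has to fall into an interval of length \<open>2 * h (U \<omega>) / \<bar>a\<bar>\<close>, and
  its density is at most \<open>1 / sqrt (2 * pi)\<close>.
\<close>
lemma (in prob_space) std_normal_small_ball_le:
  assumes [measurable]: "random_variable N U"
    and indep: "distr M (borel \<Otimes>\<^sub>M N) (\<lambda>\<omega>. (Z \<omega>, U \<omega>)) = distr M borel Z \<Otimes>\<^sub>M distr M N U"
    and Z: "distributed M lborel Z std_normal_density"
    and [measurable]: "b \<in> borel_measurable N" "h \<in> borel_measurable N"
    and h: "\<And>u. 0 \<le> h u" and int: "integrable M (\<lambda>\<omega>. h (U \<omega>))" and a: "a \<noteq> 0"
  shows "prob {\<omega> \<in> space M. \<bar>a * Z \<omega> + b (U \<omega>)\<bar> \<le> h (U \<omega>)}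
    \<le> 2 / sqrt (2 * pi) / \<bar>a\<bar> * expectation (\<lambda>\<omega>. h (U \<omega>))"
proof -
  have [measurable]: "Z \<in> borel_measurable M"
    using distributed_measurable[OF Z] by simp
  define c where "c = 2 / sqrt (2 * pi) / \<bar>a\<bar>"
  have c: "c \<ge> 0" unfolding c_def by simp
  define J D where "J = distr M borel Z" and "D = distr M N U"
  have J: "J = density lborel (\<lambda>x. ennreal (std_normal_density x))"
    using distributed_distr_eq_density[OF Z] unfolding J_def
    by (simp add: distr_cong[of M M borel lborel])
  interpret J: prob_space J unfolding J_def by (rule prob_space_distr) simp
  interpret D: prob_space D unfolding D_def by (rule prob_space_distr) simp
  interpret JD: pair_sigma_finite J D ..
  define S where "S = {x \<in> space (borel \<Otimes>\<^sub>M N). \<bar>a * fst x + b (snd x)\<bar> \<le> h (snd x)}"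
  have S: "S \<in> sets (borel \<Otimes>\<^sub>M N)" unfolding S_def by measurable
  have pair: "J \<Otimes>\<^sub>M D = distr M (borel \<Otimes>\<^sub>M N) (\<lambda>\<omega>. (Z \<omega>, U \<omega>))"
    using indep unfolding J_def D_def by simp
  have slice: "emeasure J ((\<lambda>z. (z, u)) -` S) \<le> ennreal (c * h u)" if "u \<in> space N" for u
  proof -
    define I where "I = {- b u / a - h u / \<bar>a\<bar> .. - b u / a + h u / \<bar>a\<bar>}"
    have "z \<in> (\<lambda>z. (z, u)) -` S \<longleftrightarrow> z \<in> I" for z
    proof -
      have "\<bar>a * z + b u\<bar> = \<bar>a\<bar> * \<bar>z - (- b u / a)\<bar>"
        using a by (simp flip: abs_mult add: field_simps)
      then have "\<bar>a * z + b u\<bar> \<le> h u \<longleftrightarrow> \<bar>z - (- b u / a)\<bar> \<le> h u / \<bar>a\<bar>"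
        using a by (simp add: field_simps)
      also have "\<dots> \<longleftrightarrow> z \<in> I" unfolding I_def atLeastAtMost_iff by linarith
      finally show ?thesis using that by (simp add: S_def space_pair_measure)
    qed
    then have "(\<lambda>z. (z, u)) -` S = I" by blast
    then have "emeasure J ((\<lambda>z. (z, u)) -` S)
        = (\<integral>\<^sup>+x. ennreal (std_normal_density x) * indicator I x \<partial>lborel)"
      unfolding J by (simp add: emeasure_density I_def)
    also have "\<dots> \<le> (\<integral>\<^sup>+x. ennreal (1 / sqrt (2 * pi)) * indicator I x \<partial>lborel)"
      by (intro nn_integral_mono mult_right_mono ennreal_leI std_normal_density_le) simp
    also have "\<dots> = ennreal (1 / sqrt (2 * pi)) * emeasure lborel I"
      by (simp add: I_def nn_integral_cmult_indicator)
    also have "emeasure lborel I = ennreal (2 * (h u / \<bar>a\<bar>))"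
      using h[of u] a by (simp add: I_def)
    also have "ennreal (1 / sqrt (2 * pi)) * \<dots> = ennreal (c * h u)"
      unfolding c_def by (subst ennreal_mult[symmetric]) (auto simp: h)
    finally show ?thesis .
  qed
  have "emeasure M {\<omega> \<in> space M. \<bar>a * Z \<omega> + b (U \<omega>)\<bar> \<le> h (U \<omega>)} = emeasure (J \<Otimes>\<^sub>M D) S"
    unfolding pair using S by (subst emeasure_distr)
      (auto simp: S_def space_pair_measure measurable_space[of U M N] intro!: arg_cong[where f = "emeasure M"])
  also have "\<dots> = (\<integral>\<^sup>+u. emeasure J ((\<lambda>z. (z, u)) -` S) \<partial>D)"
    using S by (intro JD.emeasure_pair_measure_alt2) (simp add: J_def D_def cong: sets_pair_measure_cong)
  also have "\<dots> \<le> (\<integral>\<^sup>+u. ennreal (c * h u) \<partial>D)"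
    by (intro nn_integral_mono slice) (simp add: D_def)
  also have "\<dots> = (\<integral>\<^sup>+\<omega>. ennreal (c * h (U \<omega>)) \<partial>M)"
    unfolding D_def by (rule nn_integral_distr) simp_all
  also have "\<dots> = ennreal (c * expectation (\<lambda>\<omega>. h (U \<omega>)))"
    using c h int by (subst nn_integral_eq_integral) auto
  finally have "emeasure M {\<omega> \<in> space M. \<bar>a * Z \<omega> + b (U \<omega>)\<bar> \<le> h (U \<omega>)}
      \<le> ennreal (c * expectation (\<lambda>\<omega>. h (U \<omega>)))" .
  then have "ennreal (prob {\<omega> \<in> space M. \<bar>a * Z \<omega> + b (U \<omega>)\<bar> \<le> h (U \<omega>)})
      \<le> ennreal (c * expectation (\<lambda>\<omega>. h (U \<omega>)))"
    unfolding emeasure_eq_measure .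
  moreover have "c * expectation (\<lambda>\<omega>. h (U \<omega>)) \<ge> 0"
    using c h by (intro mult_nonneg_nonneg integral_nonneg_AE) auto
  ultimately show ?thesis unfolding c_def by (simp add: ennreal_le_iff)
qed

lemma std_gaussian_vector_measurable:
  assumes "std_gaussian_vector M \<mu>"
  shows "\<mu> \<in> borel_measurable M"
proof -
  have "(\<lambda>\<omega>. \<mu> \<omega> $ k) \<in> borel_measurable M" for k
    using assms distributed_measurable[of M lborel "\<lambda>\<omega>. \<mu> \<omega> $ k"]
    by (auto simp: std_gaussian_vector_def)
  then show ?thesis
    by (subst borel_measurable_euclidean_space) (auto simp: Basis_vec_def inner_axis)
qed

text \<open>
  The \<open>k\<close>-th coordinate is independent of the remaining ones, whose Euclidean norm has expectation
  at most the square root of \<open>d - 1\<close> by Jensen's inequality.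
\<close>
lemma std_gaussian_vector_small_ball_le:
  fixes \<mu> :: "'a \<Rightarrow> real^'d::finite" and \<delta> :: "real^'d"
  assumes gauss: "std_gaussian_vector M \<mu>" and k: "\<delta> $ k \<noteq> 0" and c: "c \<ge> 0"
  shows "measure M {\<omega> \<in> space M. \<bar>\<delta> \<bullet> \<mu> \<omega>\<bar> \<le> c * sqrt (\<Sum>l\<in>UNIV-{k}. (\<mu> \<omega> $ l)\<^sup>2)}
    \<le> 2 / sqrt (2 * pi) * (c / \<bar>\<delta> $ k\<bar>) * sqrt (real CARD('d) - 1)"
proof -
  interpret prob_space M using gauss by (simp add: std_gaussian_vector_def)
  have normal: "distributed M lborel (\<lambda>\<omega>. \<mu> \<omega> $ l) std_normal_density" for l
    using gauss by (simp add: std_gaussian_vector_def)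
  have [measurable]: "(\<lambda>\<omega>. \<mu> \<omega> $ l) \<in> borel_measurable M" for l
    using distributed_measurable[OF normal[of l]] by simp
  define N :: "('d \<Rightarrow> real) measure" where "N = PiM (UNIV - {k}) (\<lambda>_. borel)"
  define U where "U = (\<lambda>\<omega>. restrict (\<lambda>l. \<mu> \<omega> $ l) (UNIV - {k}))"
  define b where "b = (\<lambda>u. \<Sum>l\<in>UNIV-{k}. \<delta> $ l * u l)"
  define g where "g = (\<lambda>u. sqrt (\<Sum>l\<in>UNIV-{k}. (u l)\<^sup>2))"
  have "indep_var (PiM {k} (\<lambda>_. borel)) (\<lambda>\<omega>. restrict (\<lambda>l. \<mu> \<omega> $ l) {k}) N U"
    unfolding N_def U_def using gauss
    by (intro indep_var_restrict[where I = UNIV]) (auto simp: std_gaussian_vector_def)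
  then have U [measurable]: "random_variable N U"
    and joint: "distr M (PiM {k} (\<lambda>_. borel) \<Otimes>\<^sub>M N) (\<lambda>\<omega>. (restrict (\<lambda>l. \<mu> \<omega> $ l) {k}, U \<omega>))
      = distr M (PiM {k} (\<lambda>_. borel)) (\<lambda>\<omega>. restrict (\<lambda>l. \<mu> \<omega> $ l) {k}) \<Otimes>\<^sub>M distr M N U" (is "_ = ?P \<Otimes>\<^sub>M _")
    and [measurable]: "random_variable (PiM {k} (\<lambda>_. borel)) (\<lambda>\<omega>. restrict (\<lambda>l. \<mu> \<omega> $ l) {k})"
    unfolding indep_var_distribution_eq by simp_all
  interpret D: prob_space "distr M N U" by (rule prob_space_distr) (rule U)
  have "distr M borel (\<lambda>\<omega>. \<mu> \<omega> $ k) \<Otimes>\<^sub>M distr M N U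
      = distr ?P borel (\<lambda>z. z k) \<Otimes>\<^sub>M distr (distr M N U) N (\<lambda>u. u)"
    by (simp add: distr_distr comp_def)
  also have "\<dots> = distr (?P \<Otimes>\<^sub>M distr M N U) (borel \<Otimes>\<^sub>M N) (\<lambda>(z, u). (z k, u))"
    by (rule pair_measure_distr) (simp_all add: distr_distr comp_def D.sigma_finite_measure_axioms)
  also have "\<dots> = distr M (borel \<Otimes>\<^sub>M N) (\<lambda>\<omega>. (\<mu> \<omega> $ k, U \<omega>))"
    unfolding joint[symmetric] by (simp add: distr_distr comp_def)
  finally have indep: "distr M (borel \<Otimes>\<^sub>M N) (\<lambda>\<omega>. (\<mu> \<omega> $ k, U \<omega>))
      = distr M borel (\<lambda>\<omega>. \<mu> \<omega> $ k) \<Otimes>\<^sub>M distr M N U" by simp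
  have gU: "g (U \<omega>) = sqrt (\<Sum>l\<in>UNIV-{k}. (\<mu> \<omega> $ l)\<^sup>2)" for \<omega>
    unfolding g_def U_def by simp
  have sq_int: "integrable M (\<lambda>\<omega>. (\<mu> \<omega> $ l)\<^sup>2)" for l
    using distributed_integrable[OF normal[of l], of "\<lambda>x. x\<^sup>2"] integrable_std_normal_moment[of 2] by simp
  have sq_exp: "expectation (\<lambda>\<omega>. (\<mu> \<omega> $ l)\<^sup>2) = 1" for l
    using standard_normal_distributed_variance[OF normal[of l]]
      standard_normal_distributed_expectation[OF normal[of l]] by simp
  have gsq: "(g (U \<omega>))\<^sup>2 = (\<Sum>l\<in>UNIV-{k}. (\<mu> \<omega> $ l)\<^sup>2)" for \<omega>
    unfolding gU by (simp add: sum_nonneg)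
  have g2_int: "integrable M (\<lambda>\<omega>. (g (U \<omega>))\<^sup>2)" unfolding gsq by (intro Bochner_Integration.integrable_sum sq_int)
  have g2_exp: "expectation (\<lambda>\<omega>. (g (U \<omega>))\<^sup>2) = real CARD('d) - 1"
    unfolding gsq by (simp add: sq_int sq_exp card_Diff_singleton)
  have g_int: "integrable M (\<lambda>\<omega>. g (U \<omega>))"
    by (rule square_integrable_imp_integrable[OF _ g2_int]) (simp add: gU)
  \<comment> \<open>Nonnegativity of the variance is the instance of Jensen's inequality that is needed.\<close>
  have "0 \<le> variance (\<lambda>\<omega>. g (U \<omega>))" by (rule variance_positive)
  then have "(expectation (\<lambda>\<omega>. g (U \<omega>)))\<^sup>2 \<le> real CARD('d) - 1"
    unfolding variance_eq[OF g_int g2_int] g2_exp by simp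
  then have g_exp: "expectation (\<lambda>\<omega>. g (U \<omega>)) \<le> sqrt (real CARD('d) - 1)"
    by (rule real_le_rsqrt)
  have "\<delta> \<bullet> \<mu> \<omega> = \<delta> $ k * \<mu> \<omega> $ k + b (U \<omega>)" for \<omega>
    unfolding inner_vec_def b_def U_def by (subst sum.remove[of _ k]) auto
  then have "measure M {\<omega> \<in> space M. \<bar>\<delta> \<bullet> \<mu> \<omega>\<bar> \<le> c * sqrt (\<Sum>l\<in>UNIV-{k}. (\<mu> \<omega> $ l)\<^sup>2)}
      = prob {\<omega> \<in> space M. \<bar>\<delta> $ k * \<mu> \<omega> $ k + b (U \<omega>)\<bar> \<le> c * g (U \<omega>)}" by (simp add: gU)
  also have "\<dots> \<le> 2 / sqrt (2 * pi) / \<bar>\<delta> $ k\<bar> * expectation (\<lambda>\<omega>. c * g (U \<omega>))"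
    by (rule std_normal_small_ball_le[OF U indep normal _ _ _ _ k, of b "\<lambda>u. c * g u"])
      (use c g_int in \<open>auto simp: b_def g_def N_def sum_nonneg\<close>)
  also have "\<dots> \<le> 2 / sqrt (2 * pi) / \<bar>\<delta> $ k\<bar> * (c * sqrt (real CARD('d) - 1))"
    using g_exp c by (intro mult_left_mono) (auto intro: mult_left_mono)
  finally show ?thesis by simp
qed

lemma std_gaussian_vector_AE_inner_neq_0:
  fixes \<mu> :: "'a \<Rightarrow> real^'d::finite" and \<delta> :: "real^'d"
  assumes gauss: "std_gaussian_vector M \<mu>" and "\<delta> \<noteq> 0"
  shows "AE \<omega> in M. \<delta> \<bullet> \<mu> \<omega> \<noteq> 0"
proof -
  interpret prob_space M using gauss by (simp add: std_gaussian_vector_def)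
  note [measurable] = std_gaussian_vector_measurable[OF gauss]
  obtain k where "\<delta> $ k \<noteq> 0" using \<open>\<delta> \<noteq> 0\<close> by (auto simp: vec_eq_iff)
  from std_gaussian_vector_small_ball_le[OF gauss this, of 0]
  have "prob {\<omega> \<in> space M. \<delta> \<bullet> \<mu> \<omega> = 0} = 0" by (simp add: measure_le_0_iff)
  then show ?thesis by (subst (asm) prob_eq_0) auto
qed

text \<open>
  The event that \<open>norm \<delta> * norm x / \<bar>\<delta> \<bullet> x\<bar>\<close> is large involves the coordinate \<open>x $ k\<close> on both
  sides.  Since \<open>\<delta> $ k * x $ k\<close> is \<open>\<delta> \<bullet> x\<close> up to the other coordinates, it can be eliminated from
  the norm, which leaves a threshold that depends on the other coordinates only.
\<close>
lemma norm_mult_norm_le_inner: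
  fixes \<delta> x :: "real^'d"
  assumes max: "\<And>l. \<bar>\<delta> $ l\<bar> \<le> \<bar>\<delta> $ k\<bar>"
    and large: "real CARD('d) * (1 + sqrt (real CARD('d) - 1)) * \<bar>\<delta> $ k\<bar> * sqrt (\<Sum>l\<in>UNIV-{k}. (x $ l)\<^sup>2)
      \<le> (1 + R - real CARD('d)) * \<bar>\<delta> \<bullet> x\<bar>"
  shows "sqrt (real CARD('d)) * norm \<delta> * norm x \<le> (1 + R) * \<bar>\<delta> \<bullet> x\<bar>"
proof -
  let ?d = "real CARD('d)"
  define q where "q = L2_set (($) x) (UNIV - {k})"
  have q: "q = sqrt (\<Sum>l\<in>UNIV-{k}. (x $ l)\<^sup>2)" by (simp add: q_def L2_set_def)
  have q0: "q \<ge> 0" unfolding q_def by simp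
  have d1: "?d \<ge> 1" by (simp add: Suc_le_eq)
  have "norm \<delta> \<le> L2_set (\<lambda>l. \<bar>\<delta> $ k\<bar>) (UNIV :: 'd set)"
    unfolding norm_vec_def by (intro L2_set_mono) (auto simp: max)
  then have n\<delta>: "norm \<delta> \<le> sqrt ?d * \<bar>\<delta> $ k\<bar>" by (simp add: L2_set_def real_sqrt_mult)
  have "(norm x)\<^sup>2 = (x $ k)\<^sup>2 + q\<^sup>2"
    unfolding q norm_vec_def L2_set_def by (simp add: sum_nonneg sum.remove[of _ k])
  also have "\<dots> \<le> (\<bar>x $ k\<bar> + q)\<^sup>2" using q0 by (simp add: power2_sum)
  finally have nx: "norm x \<le> \<bar>x $ k\<bar> + q" by (rule power2_le_imp_le) (use q0 in simp)
  have "\<bar>\<Sum>l\<in>UNIV-{k}. \<delta> $ l * x $ l\<bar> \<le> (\<Sum>l\<in>UNIV-{k}. \<bar>\<delta> $ l\<bar> * \<bar>x $ l\<bar>)"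
    by (rule order_trans[OF sum_abs]) (simp add: abs_mult)
  also have "\<dots> \<le> L2_set (($) \<delta>) (UNIV - {k}) * q" unfolding q_def by (rule L2_set_mult_ineq)
  also have "\<dots> \<le> (sqrt (?d - 1) * \<bar>\<delta> $ k\<bar>) * q"
  proof (intro mult_right_mono q0)
    have "L2_set (($) \<delta>) (UNIV - {k}) \<le> sqrt (\<Sum>l\<in>UNIV-{k}. (\<delta> $ k)\<^sup>2)"
      unfolding L2_set_def using max by (intro real_sqrt_le_mono sum_mono) (simp add: abs_le_square_iff)
    then show "L2_set (($) \<delta>) (UNIV - {k}) \<le> sqrt (?d - 1) * \<bar>\<delta> $ k\<bar>"
      using d1 by (simp add: card_Diff_singleton real_sqrt_mult of_nat_diff)
  qed
  finally have rest: "\<bar>\<Sum>l\<in>UNIV-{k}. \<delta> $ l * x $ l\<bar> \<le> sqrt (?d - 1) * \<bar>\<delta> $ k\<bar> * q" .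
  have "\<delta> \<bullet> x = \<delta> $ k * x $ k + (\<Sum>l\<in>UNIV-{k}. \<delta> $ l * x $ l)"
    unfolding inner_vec_def by (simp add: sum.remove[of _ k])
  with rest have kk: "\<bar>\<delta> $ k\<bar> * \<bar>x $ k\<bar> \<le> \<bar>\<delta> \<bullet> x\<bar> + sqrt (?d - 1) * \<bar>\<delta> $ k\<bar> * q"
    unfolding abs_mult[symmetric] by linarith
  have "sqrt ?d * norm \<delta> * norm x \<le> sqrt ?d * (sqrt ?d * \<bar>\<delta> $ k\<bar>) * (\<bar>x $ k\<bar> + q)"
    using d1 q0 by (intro mult_mono n\<delta> nx order_refl) auto
  also have "\<dots> = (sqrt ?d * sqrt ?d) * (\<bar>\<delta> $ k\<bar> * \<bar>x $ k\<bar> + \<bar>\<delta> $ k\<bar> * q)"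
    by (simp only: distrib_left mult_ac)
  also have "\<dots> = ?d * (\<bar>\<delta> $ k\<bar> * \<bar>x $ k\<bar> + \<bar>\<delta> $ k\<bar> * q)" by simp
  also have "\<dots> \<le> ?d * (\<bar>\<delta> \<bullet> x\<bar> + sqrt (?d - 1) * \<bar>\<delta> $ k\<bar> * q + \<bar>\<delta> $ k\<bar> * q)"
    using kk by (intro mult_left_mono) auto
  also have "\<dots> = ?d * \<bar>\<delta> \<bullet> x\<bar> + ?d * (1 + sqrt (?d - 1)) * \<bar>\<delta> $ k\<bar> * q" by (simp add: algebra_simps)
  also have "\<dots> \<le> (1 + R) * \<bar>\<delta> \<bullet> x\<bar>" using large unfolding q[symmetric] by (simp add: algebra_simps)
  finally show ?thesis .
qed

text \<open>
  With \<open>s = sqrt (d - 1)\<close> the inequality \<open>2 * s \<le> d\<close> gives \<open>2 * (1 + s) * s \<le> 3 * d - 2\<close>; the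
  remaining slack \<open>2 * R\<close> absorbs the loss from \<open>1 + R - d\<close> in the denominator.
\<close>
lemma tail_constant_le:
  fixes d R :: real
  assumes d: "d \<ge> 1" and R: "R \<ge> 2 * d\<^sup>2"
  shows "2 * (d * (1 + sqrt (d - 1)) / (1 + R - d)) * sqrt (d - 1) \<le> 3 * d\<^sup>2 / R"
proof -
  define s where "s = sqrt (d - 1)"
  have ds: "d = s\<^sup>2 + 1" using d by (simp add: s_def)
  have dd: "d\<^sup>2 \<ge> d" using d by (simp add: power2_eq_square)
  have pos: "R > 0" "1 + R - d > 0" using d R dd by linarith+
  have "2 * s \<le> d" using zero_le_power2[of "s - 1"] by (simp add: ds power2_eq_square algebra_simps)
  then have "2 * (1 + s) * s \<le> 3 * d - 2" unfolding ds by (simp add: power2_eq_square algebra_simps)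
  then have "2 * (1 + s) * s * R \<le> (3 * d - 2) * R" using pos by (intro mult_right_mono) auto
  also have "\<dots> \<le> 3 * d * (1 + R - d)"
  proof -
    have "3 * d\<^sup>2 \<le> 2 * R + 3 * d" using R d zero_le_power2[of d] by linarith
    then show ?thesis by (simp add: power2_eq_square algebra_simps)
  qed
  finally have "d * (2 * (1 + s) * s * R) \<le> d * (3 * d * (1 + R - d))" using d by (intro mult_left_mono) auto
  then show ?thesis using pos unfolding s_def[symmetric] by (simp add: field_simps power2_eq_square)
qed

lemma std_gaussian_vector_norm_mult_norm_le_inner:
  fixes \<mu> :: "'a \<Rightarrow> real^'d::finite" and \<delta> :: "real^'d"
  assumes gauss: "std_gaussian_vector M \<mu>" and \<delta>: "\<delta> \<noteq> 0" and R: "R \<ge> 2 * (real CARD('d))\<^sup>2"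
  obtains S where "S \<in> sets M" "measure M S \<le> 3 / sqrt (2 * pi) * (real CARD('d))\<^sup>2 / R"
    "\<And>\<omega>. \<omega> \<in> space M \<Longrightarrow> \<omega> \<notin> S \<Longrightarrow>
      \<delta> \<bullet> \<mu> \<omega> \<noteq> 0 \<and> sqrt (real CARD('d)) * norm \<delta> * norm (\<mu> \<omega>) \<le> (1 + R) * \<bar>\<delta> \<bullet> \<mu> \<omega>\<bar>"
proof -
  note [measurable] = std_gaussian_vector_measurable[OF gauss]
  have [measurable]: "(\<lambda>\<omega>. \<mu> \<omega> $ l) \<in> borel_measurable M" for l
    using gauss distributed_measurable[of M lborel "\<lambda>\<omega>. \<mu> \<omega> $ l"] by (auto simp: std_gaussian_vector_def)
  let ?d = "real CARD('d)"
  have d1: "?d \<ge> 1" by (simp add: Suc_le_eq)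
  then have "?d\<^sup>2 \<ge> ?d" by (simp add: power2_eq_square)
  then have pos: "1 + R - ?d > 0" using R d1 by linarith
  obtain k where max: "\<And>l. \<bar>\<delta> $ l\<bar> \<le> \<bar>\<delta> $ k\<bar>"
  proof -
    have "Max (range (\<lambda>l. \<bar>\<delta> $ l\<bar>)) \<in> range (\<lambda>l. \<bar>\<delta> $ l\<bar>)" by (intro Max_in) auto
    then obtain k where k: "Max (range (\<lambda>l. \<bar>\<delta> $ l\<bar>)) = \<bar>\<delta> $ k\<bar>" by (rule imageE)
    have "\<bar>\<delta> $ l\<bar> \<le> \<bar>\<delta> $ k\<bar>" for l unfolding k[symmetric] by (intro Max_ge) auto
    then show ?thesis by (rule that)
  qed
  have k: "\<delta> $ k \<noteq> 0"
  proof
    assume "\<delta> $ k = 0"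
    then have "\<delta> = 0" using max by (auto simp: vec_eq_iff)
    then show False using \<delta> by simp
  qed
  define c where "c = ?d * (1 + sqrt (?d - 1)) * \<bar>\<delta> $ k\<bar> / (1 + R - ?d)"
  have c: "c \<ge> 0" unfolding c_def using pos d1 by simp
  define S where "S = {\<omega> \<in> space M. \<bar>\<delta> \<bullet> \<mu> \<omega>\<bar> \<le> c * sqrt (\<Sum>l\<in>UNIV-{k}. (\<mu> \<omega> $ l)\<^sup>2)}"
  show ?thesis
  proof (rule that[of S])
    show "S \<in> sets M" unfolding S_def by measurable
    have "measure M S \<le> 2 / sqrt (2 * pi) * (c / \<bar>\<delta> $ k\<bar>) * sqrt (?d - 1)"
      unfolding S_def by (rule std_gaussian_vector_small_ball_le[OF gauss k c])
    also have "c / \<bar>\<delta> $ k\<bar> = ?d * (1 + sqrt (?d - 1)) / (1 + R - ?d)" using k by (simp add: c_def)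
    also have "2 / sqrt (2 * pi) * (?d * (1 + sqrt (?d - 1)) / (1 + R - ?d)) * sqrt (?d - 1)
        = 1 / sqrt (2 * pi) * (2 * (?d * (1 + sqrt (?d - 1)) / (1 + R - ?d)) * sqrt (?d - 1))" by simp
    also have "\<dots> \<le> 1 / sqrt (2 * pi) * (3 * ?d\<^sup>2 / R)"
      by (intro mult_left_mono tail_constant_le d1 R) simp
    finally show "measure M S \<le> 3 / sqrt (2 * pi) * ?d\<^sup>2 / R" by simp
  next
    fix \<omega> assume "\<omega> \<in> space M" "\<omega> \<notin> S"
    then have *: "c * sqrt (\<Sum>l\<in>UNIV-{k}. (\<mu> \<omega> $ l)\<^sup>2) < \<bar>\<delta> \<bullet> \<mu> \<omega>\<bar>" by (simp add: S_def)
    moreover have "0 \<le> c * sqrt (\<Sum>l\<in>UNIV-{k}. (\<mu> \<omega> $ l)\<^sup>2)" using c by (simp add: sum_nonneg)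
    ultimately have nz: "\<delta> \<bullet> \<mu> \<omega> \<noteq> 0" by linarith
    have "(1 + R - ?d) * (c * sqrt (\<Sum>l\<in>UNIV-{k}. (\<mu> \<omega> $ l)\<^sup>2)) \<le> (1 + R - ?d) * \<bar>\<delta> \<bullet> \<mu> \<omega>\<bar>"
      using * pos by (intro mult_left_mono) auto
    moreover have "(1 + R - ?d) * c = ?d * (1 + sqrt (?d - 1)) * \<bar>\<delta> $ k\<bar>" using pos by (simp add: c_def)
    ultimately have "?d * (1 + sqrt (?d - 1)) * \<bar>\<delta> $ k\<bar> * sqrt (\<Sum>l\<in>UNIV-{k}. (\<mu> \<omega> $ l)\<^sup>2)
        \<le> (1 + R - ?d) * \<bar>\<delta> \<bullet> \<mu> \<omega>\<bar>" by (simp only: mult.assoc[symmetric])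
    from nz norm_mult_norm_le_inner[OF max this]
    show "\<delta> \<bullet> \<mu> \<omega> \<noteq> 0 \<and> sqrt ?d * norm \<delta> * norm (\<mu> \<omega>) \<le> (1 + R) * \<bar>\<delta> \<bullet> \<mu> \<omega>\<bar>" ..
  qed
qed

section \<open>The probabilistic estimate\<close>

theorem theorem15:
  fixes A E :: "'d::finite \<Rightarrow> real^'n^'n"
    and X\<^sub>0 :: "real^'n^'n"
    and \<theta>\<^sub>0 \<theta> :: "real^'d"
    and m :: nat
    and R :: real
    and M :: "'a measure"
    and \<mu> :: "'a \<Rightarrow> real^'d"
  assumes d: "CARD('d) \<ge> 2"
    and sdc: "sdc_family A"
    and posdef: "posdef_family A"
    and E_norm: "(\<Sum>k\<in>UNIV. (frobenius_norm (E k))\<^sup>2) = 1"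
    and X\<^sub>0: "diagonalizes X\<^sub>0 A"
    and \<theta>\<^sub>0: "invertible (lincomb A \<theta>\<^sub>0)"
    and m: "m = card (eigenvalue_vectors A X\<^sub>0 \<theta>\<^sub>0)"
    and gauss: "std_gaussian_vector M \<mu>"
    and \<theta>: "\<theta> = (\<chi> k. 1 / real CARD('d))"
    and R: "R > 0"
    and nondegenerate:
      "\<not> (m = 1 \<and> CARD('n) \<ge> 2 \<and> CARD('d) \<ge> 3 \<and> R < sqrt (real CARD('d)) - 1)"
  shows "measure M {\<omega> \<in> space M.
           \<exists>C. \<forall>\<^sub>F \<epsilon> in at_right 0. \<forall>X.
             (let A' = (\<lambda>k. A k + \<epsilon> *\<^sub>R E k) in
               invertible X \<and>
               diagonal_matrix (congr X (lincomb A' (\<mu> \<omega>))) \<and>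
               diagonal_matrix (congr X (lincomb A' \<theta>)) \<longrightarrow>
               1 / (spectral_norm X)\<^sup>2 *
                   sqrt (\<Sum>k\<in>UNIV. (frobenius_norm (offdiag (congr X (A' k))))\<^sup>2)
                 \<le> (1 + R) * \<epsilon> + C * \<epsilon>\<^sup>2)}
         \<ge> 1 - 3 / sqrt (2 * pi) * (real CARD('d))\<^sup>2 * real m * (real m - 1) / R"
    (is "measure M {\<omega> \<in> space M. ?good (\<mu> \<omega>)} \<ge> _")
proof -
  interpret prob_space M using gauss by (simp add: std_gaussian_vector_def)
  let ?d = "real CARD('d)"
  define G where "G = {\<omega> \<in> space M. ?good (\<mu> \<omega>)}"
  have G: "G \<in> events"
    unfolding G_def
    by (rule measurable_sets_Collect[OF std_gaussian_vector_measurable[OF gauss]])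
      (use perturbation_estimate_borel[of A E \<theta> "1 + R"] in \<open>simp only: space_borel UNIV_I simp_thms\<close>)
  define v where "v = (\<lambda>p. \<chi> k. congr X\<^sub>0 (A k) $ p $ p)"
  define \<kappa> where "\<kappa> = (\<lambda>p. v p /\<^sub>R (v p \<bullet> \<theta>))"
  have v_pos: "v p \<bullet> \<xi> > 0" if "\<And>k. \<xi> $ k > 0" for p \<xi>
  proof -
    have "column p X\<^sub>0 \<noteq> 0"
    proof
      assume "column p X\<^sub>0 = 0"
      then have "X\<^sub>0 *v axis p 1 = 0" by (simp add: matrix_vector_mult_basis)
      moreover obtain X' where "X' ** X\<^sub>0 = mat 1" using X\<^sub>0 by (auto simp: diagonalizes_def invertible_def)
      ultimately have "axis p 1 = (0 :: real^'n)"
        by (metis matrix_vector_mul_assoc matrix_vector_mul_lid matrix_vector_mult_0_right)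
      then show False by (simp add: axis_eq_0_iff)
    qed
    moreover have "posdef_matrix (lincomb A \<xi>)" using posdef that by (simp add: posdef_family_def)
    moreover have "v p \<bullet> \<xi> = column p X\<^sub>0 \<bullet> (lincomb A \<xi> *v column p X\<^sub>0)"
      by (simp add: v_def flip: congr_lincomb_component congr_component)
    ultimately show ?thesis by (simp add: posdef_matrix_def)
  qed
  have pos: "v p \<bullet> \<theta> > 0" for p by (rule v_pos) (simp add: \<theta>)
  have \<kappa>\<theta>: "\<kappa> p \<bullet> \<theta> = 1" for p using pos[of p] by (simp add: \<kappa>_def)
  \<comment> \<open>If \<open>v p $ k\<close> were negative, a suitable multiple of the all-ones vector added to the \<open>k\<close>-th unit vector
     would be a positive direction orthogonal to \<open>v p\<close>.\<close>
  have v_nonneg: "v p $ k \<ge> 0" for p k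
  proof (rule ccontr)
    assume "\<not> v p $ k \<ge> 0"
    define s where "s = v p \<bullet> 1"
    have s: "s > 0" unfolding s_def by (rule v_pos) simp
    define \<eta> where "\<eta> = - v p $ k / s"
    have "\<eta> > 0" using s \<open>\<not> v p $ k \<ge> 0\<close> by (simp add: \<eta>_def divide_neg_pos)
    then have "v p \<bullet> (\<eta> *\<^sub>R 1 + axis k 1) > 0" by (intro v_pos) (simp add: axis_def)
    moreover have "v p \<bullet> (\<eta> *\<^sub>R 1 + axis k 1) = \<eta> * s + v p $ k"
      by (simp only: inner_add_right inner_scaleR_right s_def inner_axis inner_real_def mult_1_right)
    moreover have "\<eta> * s + v p $ k = 0" using s by (simp add: \<eta>_def)
    ultimately show False by simp
  qed
  have norm_\<theta>: "norm \<theta> = 1 / sqrt ?d"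
    unfolding \<theta> norm_vec_def L2_set_def by (simp add: power_divide power2_eq_square real_sqrt_divide)
  have norm_\<kappa>: "norm (\<kappa> p) \<le> ?d" for p
  proof -
    have "norm (\<kappa> p) \<le> (\<Sum>k\<in>UNIV. \<bar>\<kappa> p $ k\<bar>)" by (rule norm_le_l1_cart)
    also have "\<dots> = (\<Sum>k\<in>UNIV. \<kappa> p $ k)"
      using v_nonneg[of p] pos[of p] by (intro sum.cong) (simp_all add: \<kappa>_def)
    also have "\<dots> = ?d * (\<kappa> p \<bullet> \<theta>)" by (simp add: \<theta> inner_vec_def sum_divide_distrib[symmetric])
    finally show ?thesis by (simp add: \<kappa>\<theta>)
  qed
  have \<kappa>_\<theta>_le: "norm (\<kappa> p) * norm \<theta> \<le> sqrt ?d" for p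
  proof -
    have "norm (\<kappa> p) * norm \<theta> \<le> ?d * (1 / sqrt ?d)"
      unfolding norm_\<theta> by (intro mult_right_mono norm_\<kappa>) simp
    then show ?thesis by (simp add: real_div_sqrt)
  qed
  have v\<theta>\<^sub>0: "v p \<bullet> \<theta>\<^sub>0 \<noteq> 0" for p
    unfolding v_def by (rule eigenvalue_vectors_eq(2)[OF X\<^sub>0 \<theta>\<^sub>0])
  have "eigenvalue_vectors A X\<^sub>0 \<theta>\<^sub>0 = range (\<lambda>p. v p /\<^sub>R (v p \<bullet> \<theta>\<^sub>0))"
    unfolding v_def by (rule eigenvalue_vectors_eq(1)[OF X\<^sub>0 \<theta>\<^sub>0])
  moreover have "v p /\<^sub>R (v p \<bullet> \<theta>\<^sub>0) = v q /\<^sub>R (v q \<bullet> \<theta>\<^sub>0) \<longleftrightarrow> \<kappa> p = \<kappa> q" for p q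
    unfolding \<kappa>_def using normalisation_eq_transfer v\<theta>\<^sub>0 pos by (metis less_irrefl)
  ultimately have m_card: "m = card (range \<kappa>)" unfolding m by (simp only:) (rule card_range_eq)
  then have m1: "m \<ge> 1" by (simp add: Suc_le_eq card_gt_0_iff)
  have good: "?good x"
    if "annihilation_bound (1 + R) \<theta> x (range \<kappa>)" "\<And>p q. \<kappa> p \<noteq> \<kappa> q \<Longrightarrow> \<kappa> p \<bullet> x \<noteq> \<kappa> q \<bullet> x" for x
    by (rule perturbed_offdiag_bound[OF X\<^sub>0 pos[unfolded v_def] E_norm
          that(1)[unfolded \<kappa>_def v_def] _ that(2)[unfolded \<kappa>_def v_def]])
      (use R in simp_all)
  have trivial: "1 - 3 / sqrt (2 * pi) * ?d\<^sup>2 * real m * (real m - 1) / R \<le> 1" using R m1 by simp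
  consider "CARD('n) = 1" | "CARD('d) = 2" | "CARD('n) \<ge> 2" "CARD('d) \<ge> 3"
    using d by (metis One_nat_def Suc_1 Suc_leI le_neq_implies_less less_one linorder_not_less numeral_3_eq_3 zero_less_card_finite)
  then have "measure M G \<ge> 1 - 3 / sqrt (2 * pi) * ?d\<^sup>2 * real m * (real m - 1) / R"
  proof cases
    case 1
    then have "i = j" for i j :: 'n by (metis UNIV_I card_1_singletonE singletonD)
    then have "offdiag N = 0" for N :: "real^'n^'n" by (simp add: offdiag_def vec_eq_iff)
    note offdiag_0 = this
    have nonneg: "\<forall>\<^sub>F \<epsilon> in at_right 0. 0 \<le> (1 + R) * \<epsilon> + 0 * \<epsilon>\<^sup>2"
      using R by (auto simp: eventually_at_right_field intro!: exI[of _ 1])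
    have "?good x" for x
      by (intro exI[of _ 0] eventually_mono[OF nonneg]) (simp add: offdiag_0 frobenius_norm_eq_norm Let_def)
    then have "G = space M" by (simp add: G_def)
    then show ?thesis using trivial by (simp add: prob_space)
  next
    case 2
    then obtain a b :: 'd where ab: "UNIV = {a, b}" "a \<noteq> b" by (metis card_2_iff)
    define \<delta> :: "real^'d" where "\<delta> = axis a 1 - axis b 1"
    have "\<delta> $ a = 1" using ab by (simp add: \<delta>_def axis_def)
    then have "\<delta> \<noteq> 0" by auto
    have zero: "w = 0" if "\<delta> \<bullet> x \<noteq> 0" "w \<bullet> \<theta> = 0" "w \<bullet> x = 0" for x w
    proof -
      have sum2: "sum f UNIV = f a + f b" for f :: "'d \<Rightarrow> real"
        unfolding ab(1) using ab(2) by simp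
      have "w $ b = - w $ a" using that(2) by (simp add: \<theta> inner_vec_def 2 sum2)
      moreover have "w $ a * x $ a + w $ b * x $ b = 0" using that(3) by (simp add: inner_vec_def sum2)
      ultimately have "w $ a * (x $ a - x $ b) = 0" by (simp add: algebra_simps)
      moreover have "x $ a - x $ b \<noteq> 0"
        using that(1) by (simp add: \<delta>_def inner_diff_left inner_axis' )
      ultimately have "w $ a = 0" "w $ b = 0" using \<open>w $ b = - w $ a\<close> by auto
      then show "w = 0" using ab by (metis UNIV_I empty_iff insert_iff vec_eq_iff zero_index)
    qed
    have "?good x" if "\<delta> \<bullet> x \<noteq> 0" for x
    proof (rule good)
      show "annihilation_bound (1 + R) \<theta> x (range \<kappa>)"
        unfolding annihilation_bound_def Let_def
      proof (intro ballI allI impI)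
        fix g h u a' b'
        assume "(u + a' *\<^sub>R g + b' *\<^sub>R h) \<bullet> \<theta> = 0" "(u + a' *\<^sub>R g + b' *\<^sub>R h) \<bullet> x = 0"
        then have "u + a' *\<^sub>R g + b' *\<^sub>R h = 0" by (rule zero[OF that])
        then show "norm (u + a' *\<^sub>R g + b' *\<^sub>R h) \<le> (1 + R) * norm u" using R by simp
      qed
      show "\<kappa> p \<bullet> x \<noteq> \<kappa> q \<bullet> x" if "\<kappa> p \<noteq> \<kappa> q" for p q
        using zero[OF \<open>\<delta> \<bullet> x \<noteq> 0\<close>, of "\<kappa> p - \<kappa> q"] that by (auto simp: inner_diff_left \<kappa>\<theta>)
    qed
    note good_off_hyperplane = this
    have "\<delta> \<bullet> \<mu> \<omega> \<noteq> 0 \<longrightarrow> \<omega> \<in> G" if "\<omega> \<in> space M" for \<omega>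
      unfolding G_def mem_Collect_eq by (intro impI conjI that good_off_hyperplane)
    then have "AE \<omega> in M. \<omega> \<in> G"
      by (rule AE_mp[OF std_gaussian_vector_AE_inner_neq_0[OF gauss \<open>\<delta> \<noteq> 0\<close>] AE_I2])
    then have "prob G = 1" using G by (simp add: prob_eq_1)
    then show ?thesis using trivial by simp
  next
    case 3
    show ?thesis
    proof (cases "3 / sqrt (2 * pi) * ?d\<^sup>2 * real m * (real m - 1) / R \<ge> 1")
      case True
      then show ?thesis using measure_nonneg[of M G] by linarith
    next
      case False
      \<comment> \<open>Otherwise the claimed lower bound is not positive, as \<open>3 / sqrt (2 * pi) \<ge> 1\<close> and \<open>m * (m - 1) \<ge> 2\<close>.\<close>
      have R_large: "R \<ge> 2 * ?d\<^sup>2" if "m \<ge> 2"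
      proof -
        have "sqrt (2 * pi) \<le> 3" by (rule real_le_lsqrt) (use pi_less_4 in auto)
        then have "1 \<le> 3 / sqrt (2 * pi)" by simp
        moreover have "real m * (real m - 1) \<ge> 2 * 1" using that by (intro mult_mono) auto
        ultimately have "1 * ?d\<^sup>2 * 2 \<le> 3 / sqrt (2 * pi) * ?d\<^sup>2 * (real m * (real m - 1))"
          by (intro mult_mono) auto
        also have "\<dots> < R" using False R by (simp add: field_simps)
        finally show ?thesis by simp
      qed
      have sqrt_d: "sqrt ?d \<le> 1 + R"
      proof (cases "m \<ge> 2")
        case True
        have "sqrt ?d \<le> ?d" by (rule real_le_lsqrt) (use 3 in \<open>auto simp: power2_eq_square\<close>)
        also have "\<dots> \<le> ?d\<^sup>2" using 3 by (simp add: power2_eq_square)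
        also have "\<dots> \<le> R" using R_large[OF True] by (smt (verit) zero_le_power2)
        finally show ?thesis by simp
      next
        case False
        then have "m = 1" using m1 by simp
        then show ?thesis using nondegenerate 3 by simp
      qed
      define P where "P = {(g, h) \<in> range \<kappa> \<times> range \<kappa>. g \<noteq> h}"
      have finP: "finite P" unfolding P_def by (rule finite_subset[of _ "range \<kappa> \<times> range \<kappa>"]) auto
      have "P = range \<kappa> \<times> range \<kappa> - (\<lambda>g. (g, g)) ` range \<kappa>" by (auto simp: P_def)
      then have "card P = m * m - m"
        by (simp add: card_Diff_subset card_cartesian_product card_image inj_on_def m_card image_subset_iff)
      then have cardP: "real (card P) = real m * (real m - 1)"
        using m1 by (simp add: of_nat_diff algebra_simps)
      have "\<exists>S. S \<in> events \<and> prob S \<le> 3 / sqrt (2 * pi) * ?d\<^sup>2 / R \<and>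
          (\<forall>\<omega>\<in>space M - S. (snd gh - fst gh) \<bullet> \<mu> \<omega> \<noteq> 0 \<and>
            sqrt ?d * norm (snd gh - fst gh) * norm (\<mu> \<omega>) \<le> (1 + R) * \<bar>(snd gh - fst gh) \<bullet> \<mu> \<omega>\<bar>)"
        if "gh \<in> P" for gh
      proof -
        have "m \<ge> 2"
        proof (rule ccontr)
          assume "\<not> m \<ge> 2"
          then have "m = 1" using m1 by simp
          then have "card P = 0" using cardP by simp
          then show False using that finP by simp
        qed
        moreover have "snd gh - fst gh \<noteq> 0" using that by (auto simp: P_def)
        ultimately show ?thesis
          using std_gaussian_vector_norm_mult_norm_le_inner[OF gauss _ R_large] by (metis DiffE)
      qed
      then obtain S where S: "\<And>gh. gh \<in> P \<Longrightarrow> S gh \<in> events"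
        and prob_S: "\<And>gh. gh \<in> P \<Longrightarrow> prob (S gh) \<le> 3 / sqrt (2 * pi) * ?d\<^sup>2 / R"
        and out_S: "\<And>gh \<omega>. gh \<in> P \<Longrightarrow> \<omega> \<in> space M - S gh \<Longrightarrow> (snd gh - fst gh) \<bullet> \<mu> \<omega> \<noteq> 0 \<and>
            sqrt ?d * norm (snd gh - fst gh) * norm (\<mu> \<omega>) \<le> (1 + R) * \<bar>(snd gh - fst gh) \<bullet> \<mu> \<omega>\<bar>"
        by metis
      have "space M - (\<Union>gh\<in>P. S gh) \<subseteq> G"
      proof
        fix \<omega> assume \<omega>: "\<omega> \<in> space M - (\<Union>gh\<in>P. S gh)"
        have pair: "(h - g) \<bullet> \<mu> \<omega> \<noteq> 0 \<and> sqrt ?d * norm (h - g) * norm (\<mu> \<omega>) \<le> (1 + R) * \<bar>(h - g) \<bullet> \<mu> \<omega>\<bar>"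
          if "g \<in> range \<kappa>" "h \<in> range \<kappa>" "g \<noteq> h" for g h
          using out_S[of "(g, h)" \<omega>] \<omega> that by (auto simp: P_def)
        have "?good (\<mu> \<omega>)"
        proof (rule good)
          show "annihilation_bound (1 + R) \<theta> (\<mu> \<omega>) (range \<kappa>)"
            using \<kappa>_\<theta>_le \<kappa>\<theta> sqrt_d pair by (intro annihilation_boundI[where s = "sqrt ?d"]) auto
          show "\<kappa> p \<bullet> \<mu> \<omega> \<noteq> \<kappa> q \<bullet> \<mu> \<omega>" if "\<kappa> p \<noteq> \<kappa> q" for p q
            using pair[of "\<kappa> p" "\<kappa> q"] that by (simp add: inner_diff_left)
        qed
        then show "\<omega> \<in> G" using \<omega> by (simp add: G_def)
      qed
      then have "prob (space M - (\<Union>gh\<in>P. S gh)) \<le> prob G" by (intro finite_measure_mono G)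
      moreover have "(\<Union>gh\<in>P. S gh) \<in> events" using S finP by (intro sets.finite_UN) auto
      then have "prob (space M - (\<Union>gh\<in>P. S gh)) = 1 - prob (\<Union>gh\<in>P. S gh)" by (rule prob_compl)
      moreover have "prob (\<Union>gh\<in>P. S gh) \<le> (\<Sum>gh\<in>P. prob (S gh))"
        using S finP by (intro finite_measure_subadditive_finite) auto
      moreover have "(\<Sum>gh\<in>P. prob (S gh)) \<le> real (card P) * (3 / sqrt (2 * pi) * ?d\<^sup>2 / R)"
        using prob_S by (intro sum_bounded_above)
      moreover have "real (card P) * (3 / sqrt (2 * pi) * ?d\<^sup>2 / R)
          = 3 / sqrt (2 * pi) * ?d\<^sup>2 * real m * (real m - 1) / R"
        unfolding cardP by simp
      ultimately show ?thesis by linarith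
    qed
  qed
  then show ?thesis unfolding G_def .
qed

end
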